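(* Let $N\ge3$ be divisible by $3$ and $\mu\ne0$. In the continuous-time Brownian sensor model described in the context, let $T^G_h$ be the group-wise rule, i.e. the second smallest of the three group CUSUM alarm times $T^{\mathcal{G}_1}_h,T^{\mathcal{G}_2}_h,T^{\mathcal{G}_3}_h$ with threshold $h>0$. Then the detection delay of $T^G_h$ scales logarithmically with the average run length in the following manner: as $h\to\infty$, $$d(T^G_h)\le\frac{12}{\mu^2N}\left(\log(\mathrm{ARL}(T^G_h))+\log\frac{N\mu^2}{3}-1+o(1)\right).$$
   Context: **Model.** There are $N\ge 3$ sensors. Sensor $n\in\{1,\dots,N\}$ observes $\xi^{(n)}_t=\mu(t-\tau)^++W^{(n)}_t$, $t\ge 0$, where $\mu\ne0$ is a known constant, $W^{(1)},\dots,W^{(N)}$ are independent standard Brownian motions, and $\tau\in[0,\infty]$ is an unknown deterministic change time ($\tau=\infty$ means no change). One unknown sensor $n^c\in\{1,\dots,N\}$ may be compromised. Sensor $n$ reports $\bar\xi^{(n)}_t$ to a fusion center. If $n$ is honest then $\bar\xi^{(n)}=\xi^{(n)}$; for the compromised sensor, $\bar\xi^{(n^c)}$ is determined by an attack strategy $\mathfrak{s}$, which can use the signal $\xi^{(n^c)}$ observed by the attacker, and on which no assumption is made. Let $\mathcal{F}_t=\sigma\{(\bar\xi^{(1)}_s,\dots,\bar\xi^{(N)}_s):s\le t\}$. $E_{\tau,n^c,\mathfrak{s}}$ denotes expectation when the change occurs at $\tau$, the compromised sensor is $n^c$ and it uses strategy $\mathfrak{s}$ ($\tau=\infty$: no change).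 **Performance measures.** For a stopping time $T$ of $(\mathcal{F}_t)$, $$d(T)=\sup_{\tau<\infty,\,n^c,\,\mathfrak{s}}\operatorname{ess\,sup}\,E_{\tau,n^c,\mathfrak{s}}[(T-\tau)^+\mid\mathcal{F}_\tau],\qquad \mathrm{ARL}(T)=\inf_{n^c,\mathfrak{s}}E_{\infty,n^c,\mathfrak{s}}[T].$$ **Group-wise scheme.** Partition the $N$ sensors into three groups $\mathcal{G}_1,\mathcal{G}_2,\mathcal{G}_3$ of $N/3$ sensors each. For $i=1,2,3$ let $$u^{\mathcal{G}_i}_t=\sum_{n\in\mathcal{G}_i}\mu\bar\xi^{(n)}_t-\frac12\frac N3\mu^2t,\quad m^{\mathcal{G}_i}_t=\inf_{0\le s\le t}u^{\mathcal{G}_i}_s,\quad y^{\mathcal{G}_i}_t=u^{\mathcal{G}_i}_t-m^{\mathcal{G}_i}_t,\quad T^{\mathcal{G}_i}_h=\inf\{t\ge0:y^{\mathcal{G}_i}_t\ge h\}.$$ $T^G_h$ is the second order statistic (second smallest value) of $T^{\mathcal{G}_1}_h,T^{\mathcal{G}_2}_h,T^{\mathcal{G}_3}_h$. *)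

theory Defs
  imports "HOL-Probability.Probability"
begin

definition standard_brownian_motion :: "'a measure \<Rightarrow> (real \<Rightarrow> 'a \<Rightarrow> real) \<Rightarrow> bool" where
  "standard_brownian_motion M W \<longleftrightarrow>
     (\<forall>t\<ge>0. W t \<in> borel_measurable M) \<and>
     (\<forall>\<omega>\<in>space M. W 0 \<omega> = 0 \<and> continuous_on {0..} (\<lambda>t. W t \<omega>)) \<and>
     (\<forall>s t. 0 \<le> s \<and> s < t \<longrightarrow>
        distributed M lborel (\<lambda>\<omega>. W t \<omega> - W s \<omega>) (normal_density 0 (sqrt (t - s)))) \<and>
     (\<forall>(t :: nat \<Rightarrow> real) k. 0 \<le> t 0 \<and> (\<forall>i<k. t i < t (Suc i)) \<longrightarrow>
        prob_space.indep_vars M (\<lambda>_. borel) (\<lambda>i \<omega>. W (t (Suc i)) \<omega> - W (t i) \<omega>) {..<k})"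

abbreviation path_space :: "(real \<Rightarrow> real) measure" where
  "path_space \<equiv> PiM {0..} (\<lambda>_. borel)"

definition sample_path :: "(real \<Rightarrow> 'a \<Rightarrow> real) \<Rightarrow> 'a \<Rightarrow> real \<Rightarrow> real" where
  "sample_path X \<omega> = (\<lambda>t\<in>{0..}. X t \<omega>)"

text \<open>The sensors are \<open>1, \<dots>, N\<close>, and \<open>W n t \<omega>\<close> is the noise of sensor \<open>n\<close>. The variable \<open>U\<close>, with
  values in an arbitrary measurable space \<open>R\<close>, is a source of randomisation available to the
  attacker; a one-point space \<open>R\<close> gives the attacks that depend on the observed signal only.\<close>

definition sensor_noise ::
    "'a measure \<Rightarrow> 'r measure \<Rightarrow> nat \<Rightarrow> (nat \<Rightarrow> real \<Rightarrow> 'a \<Rightarrow> real) \<Rightarrow> ('a \<Rightarrow> 'r) \<Rightarrow> bool" where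
  "sensor_noise M R N W U \<longleftrightarrow>
     prob_space M \<and>
     (\<forall>n\<in>{1..N}. standard_brownian_motion M (W n)) \<and>
     prob_space.indep_vars M (\<lambda>_. path_space) (\<lambda>n. sample_path (W n)) {1..N} \<and>
     U \<in> M \<rightarrow>\<^sub>M R \<and>
     prob_space.indep_set M
       (sets (vimage_algebra (space M) U R))
       (sets (vimage_algebra (space M) (\<lambda>\<omega>. \<lambda>n\<in>{1..N}. sample_path (W n) \<omega>) (PiM {1..N} (\<lambda>_. path_space))))"

text \<open>Subtraction on \<open>ennreal\<close> is truncated at \<open>0\<close>, so \<open>ennreal t - \<tau>\<close> is \<open>(t - \<tau>)\<^sup>+\<close>, which is \<open>0\<close>
  when there is no change (\<open>\<tau> = \<infinity>\<close>).\<close>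

definition signal ::
    "real \<Rightarrow> (nat \<Rightarrow> real \<Rightarrow> 'a \<Rightarrow> real) \<Rightarrow> ennreal \<Rightarrow> nat \<Rightarrow> real \<Rightarrow> 'a \<Rightarrow> real" where
  "signal \<mu> W \<tau> n t \<omega> = \<mu> * enn2real (ennreal t - \<tau>) + W n t \<omega>"

text \<open>A strategy maps the path observed by the attacker and the randomisation to the reported path.
  Each reported value has to be a random variable; there is no causality requirement and no
  regularity requirement on the reported path.\<close>

definition attack_strategies :: "'r measure \<Rightarrow> ((real \<Rightarrow> real) \<Rightarrow> 'r \<Rightarrow> real \<Rightarrow> real) set" where
  "attack_strategies R =
     {\<ss>. \<forall>t\<ge>0. (\<lambda>(x, r). \<ss> x r t) \<in> borel_measurable (path_space \<Otimes>\<^sub>M R)}"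

definition report ::
    "real \<Rightarrow> (nat \<Rightarrow> real \<Rightarrow> 'a \<Rightarrow> real) \<Rightarrow> ('a \<Rightarrow> 'r) \<Rightarrow> ennreal \<Rightarrow> nat \<Rightarrow>
      ((real \<Rightarrow> real) \<Rightarrow> 'r \<Rightarrow> real \<Rightarrow> real) \<Rightarrow> 'a \<Rightarrow> nat \<Rightarrow> real \<Rightarrow> real" where
  "report \<mu> W U \<tau> c \<ss> \<omega> n t =
     (if n = c then \<ss> (sample_path (signal \<mu> W \<tau> c) \<omega>) (U \<omega>) t else signal \<mu> W \<tau> n t \<omega>)"

definition report_algebra :: "'a measure \<Rightarrow> nat \<Rightarrow> ('a \<Rightarrow> nat \<Rightarrow> real \<Rightarrow> real) \<Rightarrow> real \<Rightarrow> 'a measure" where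
  "report_algebra M N Y t =
     sigma (space M) {(\<lambda>\<omega>. Y \<omega> n s) -` B \<inter> space M | n s B. n \<in> {1..N} \<and> s \<in> {0..t} \<and> B \<in> sets borel}"

text \<open>Since strategies may report arbitrarily irregular paths, an alarm time need not be measurable
  under every attack. The essential supremum of a conditional expectation is therefore taken over
  the measurable majorants; by the lemma below this changes nothing for measurable \<open>X\<close>.\<close>

definition esssup_cond_exp :: "'a measure \<Rightarrow> 'a measure \<Rightarrow> ('a \<Rightarrow> ennreal) \<Rightarrow> ennreal" where
  "esssup_cond_exp M F X =
     (INF X' \<in> {X' \<in> borel_measurable M. \<forall>\<omega>\<in>space M. X \<omega> \<le> X' \<omega>}. esssup M (nn_cond_exp M F X'))"

lemma esssup_cond_exp_measurable:
  assumes "prob_space M" "subalgebra M F" and X: "X \<in> borel_measurable M"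
  shows "esssup_cond_exp M F X = esssup M (nn_cond_exp M F X)"
proof -
  interpret prob_space M by fact
  interpret finite_measure_subalgebra M F
    using assms(2) by unfold_locales
  have "esssup M (nn_cond_exp M F X) \<le> esssup M (nn_cond_exp M F X')"
    if X': "X' \<in> borel_measurable M" and le: "\<forall>\<omega>\<in>space M. X \<omega> \<le> X' \<omega>" for X'
  proof (rule esssup_AE_mono)
    show "AE x in M. nn_cond_exp M F X x \<le> nn_cond_exp M F X' x"
      by (rule nn_cond_exp_mono) (use X X' le in auto)
  qed simp
  then show ?thesis
    unfolding esssup_cond_exp_def using X by (intro antisym INF_lower INF_greatest) auto
qed

text \<open>A detection rule \<open>T\<close> is a function of the reported paths.\<close>

definition detection_delay ::
    "'a measure \<Rightarrow> 'r measure \<Rightarrow> nat \<Rightarrow> real \<Rightarrow> (nat \<Rightarrow> real \<Rightarrow> 'a \<Rightarrow> real) \<Rightarrow> ('a \<Rightarrow> 'r) \<Rightarrow>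
      ((nat \<Rightarrow> real \<Rightarrow> real) \<Rightarrow> ennreal) \<Rightarrow> ennreal" where
  "detection_delay M R N \<mu> W U T =
     (SUP \<tau>\<in>{0..}. SUP c\<in>{1..N}. SUP \<ss>\<in>attack_strategies R.
        esssup_cond_exp M (report_algebra M N (report \<mu> W U (ennreal \<tau>) c \<ss>) \<tau>)
          (\<lambda>\<omega>. T (report \<mu> W U (ennreal \<tau>) c \<ss> \<omega>) - ennreal \<tau>))"

text \<open>On a non-measurable function \<open>nn_integral\<close> is the lower integral, so attacks with a
  non-measurable alarm time are not discarded here either.\<close>

definition average_run_length ::
    "'a measure \<Rightarrow> 'r measure \<Rightarrow> nat \<Rightarrow> real \<Rightarrow> (nat \<Rightarrow> real \<Rightarrow> 'a \<Rightarrow> real) \<Rightarrow> ('a \<Rightarrow> 'r) \<Rightarrow>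
      ((nat \<Rightarrow> real \<Rightarrow> real) \<Rightarrow> ennreal) \<Rightarrow> ennreal" where
  "average_run_length M R N \<mu> W U T =
     (INF c\<in>{1..N}. INF \<ss>\<in>attack_strategies R. \<integral>\<^sup>+\<omega>. T (report \<mu> W U \<infinity> c \<ss> \<omega>) \<partial>M)"

text \<open>The running minimum lives in \<open>ereal\<close> because an attacked path can be unbounded below on a
  bounded interval.\<close>

definition group_llr :: "nat \<Rightarrow> real \<Rightarrow> nat set \<Rightarrow> (nat \<Rightarrow> real \<Rightarrow> real) \<Rightarrow> real \<Rightarrow> real" where
  "group_llr N \<mu> G x t = (\<Sum>n\<in>G. \<mu> * x n t) - 1/2 * (real N / 3) * \<mu>\<^sup>2 * t"

definition group_min :: "nat \<Rightarrow> real \<Rightarrow> nat set \<Rightarrow> (nat \<Rightarrow> real \<Rightarrow> real) \<Rightarrow> real \<Rightarrow> ereal" where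
  "group_min N \<mu> G x t = (INF s\<in>{0..t}. ereal (group_llr N \<mu> G x s))"

definition group_cusum :: "nat \<Rightarrow> real \<Rightarrow> nat set \<Rightarrow> (nat \<Rightarrow> real \<Rightarrow> real) \<Rightarrow> real \<Rightarrow> ereal" where
  "group_cusum N \<mu> G x t = ereal (group_llr N \<mu> G x t) - group_min N \<mu> G x t"

definition group_alarm ::
    "nat \<Rightarrow> real \<Rightarrow> real \<Rightarrow> nat set \<Rightarrow> (nat \<Rightarrow> real \<Rightarrow> real) \<Rightarrow> ennreal" where
  "group_alarm N \<mu> h G x = Inf {ennreal t | t. t \<ge> 0 \<and> group_cusum N \<mu> G x t \<ge> ereal h}"

definition groupwise_rule ::
    "nat \<Rightarrow> real \<Rightarrow> (nat \<Rightarrow> nat set) \<Rightarrow> real \<Rightarrow> (nat \<Rightarrow> real \<Rightarrow> real) \<Rightarrow> ennreal" where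
  "groupwise_rule N \<mu> \<G> h x =
     sort [group_alarm N \<mu> h (\<G> 1) x, group_alarm N \<mu> h (\<G> 2) x, group_alarm N \<mu> h (\<G> 3) x] ! 1"

definition three_groups :: "nat \<Rightarrow> (nat \<Rightarrow> nat set) \<Rightarrow> bool" where
  "three_groups N \<G> \<longleftrightarrow>
     (\<Union>i\<in>{1,2,3}. \<G> i) = {1..N} \<and> disjoint_family_on \<G> {1,2,3} \<and>
     (\<forall>i\<in>{1,2,3}. card (\<G> i) = N div 3)"

definition ln_ennreal :: "ennreal \<Rightarrow> ereal" where
  "ln_ennreal x = (if x = 0 then -\<infinity> else if x = \<infinity> then \<infinity> else ereal (ln (enn2real x)))"

end

theory Submission
  imports Defs
begin

text \<open>Write \<open>v = N * \<mu>\<^sup>2 / 3\<close> for the variance per unit time of the log-likelihood ratio of a group. The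
  claim compares the delay with \<open>4 / v\<close> times the logarithm of the average run length, and the two
  sides can be estimated separately in terms of the threshold \<open>h\<close>.

  At least two of the three groups contain no compromised sensor, so whatever the attack does, the
  second alarm lies between the first and the last alarm of two honest groups. After the change the
  log-likelihood ratio of an honest group drifts upwards at rate \<open>v / 2\<close>, hence the typical time to
  reach \<open>h\<close> is \<open>2 * h / v\<close>, and also the later of two such times is at most about
  \<open>8 * h / (3 * v)\<close> on average (\<open>detection_delay_le\<close>). Without a change the likelihood ratio is a
  martingale, so a rise by \<open>h\<close> within a given unit of time has probability of exponential order
  close to \<open>exp (- h)\<close>; already the rate \<open>exp (- 4/5 * h)\<close> gives a run length of at least a constant
  times \<open>exp (4/5 * h)\<close> (\<open>average_run_length_ge\<close>). Since \<open>8/3 < 4 * 4/5\<close>, the right-hand side wins for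
  all large \<open>h\<close> whatever the constants are, and the error term can be taken to be \<open>0\<close>. The true order
  of the delay is half of the upper bound claimed, which is what leaves room for these rates.

  The remaining point is the generality of the attacks. They may look into the future of their own
  signal and use external randomness, but the increments of an honest group after the change are
  independent of everything the attacker can know and of all reports before the change
  (\<open>increment_indep_past\<close>, \<open>report_algebra_past\<close>). The same independence drives the maximal
  inequality behind the run length (\<open>drifted_noise_maximal_inequality\<close>).\<close>

section \<open>Independence\<close>

text \<open>Independence between blocks and independence inside each block give joint independence: an
  intersection of events from one block is again an event of that block, so the probability of a
  finite intersection factorises first over the blocks and then inside them.\<close>

lemma (in prob_space) indep_sets_refine:
  assumes indep: "indep_sets A I"
    and stable: "\<And>i. i \<in> I \<Longrightarrow> Int_stable (A i)"
    and sub: "\<And>i j. i \<in> I \<Longrightarrow> j \<in> K i \<Longrightarrow> B i j \<subseteq> A i"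
    and inner: "\<And>i. i \<in> I \<Longrightarrow> indep_sets (B i) (K i)"
  shows "indep_sets (\<lambda>(i, j). B i j) (SIGMA i:I. K i)"
proof (rule indep_setsI)
  fix p assume "p \<in> (SIGMA i:I. K i)"
  then show "(case p of (i, j) \<Rightarrow> B i j) \<subseteq> events"
    using inner by (auto simp: indep_sets_def)
next
  fix E J
  assume J: "J \<noteq> {}" "J \<subseteq> (SIGMA i:I. K i)" "finite J"
    and "\<forall>p\<in>J. E p \<in> (case p of (i, j) \<Rightarrow> B i j)"
  then have E: "\<And>i j. (i, j) \<in> J \<Longrightarrow> E (i, j) \<in> B i j" by auto
  define J' where "J' i = {j. (i, j) \<in> J}" for i
  have fin: "finite (J' i)" for i
    using finite_imageI[OF J(3), of snd] unfolding J'_def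
    by (rule rev_finite_subset) force
  have ne: "J' i \<noteq> {}" if "i \<in> fst ` J" for i using that by (auto simp: J'_def)
  have sI: "fst ` J \<subseteq> I" using J(2) by auto
  have sK: "J' i \<subseteq> K i" for i using J(2) by (auto simp: J'_def)
  have eq: "J = (SIGMA i:fst ` J. J' i)" by (force simp: J'_def)
  have inA: "(\<Inter>j\<in>J' i. E (i, j)) \<in> A i" if i: "i \<in> fst ` J" for i
  proof -
    have "i \<in> I" using sI i by blast
    have "E (i, j) \<in> A i" if "j \<in> J' i" for j
      using sub[OF \<open>i \<in> I\<close>, of j] E[of i j] that sK by (auto simp: J'_def)
    with fin ne[OF i] show ?thesis
    proof (induction rule: finite_ne_induct)
      case (insert j F)
      then show ?case using stable[OF \<open>i \<in> I\<close>] by (auto simp: Int_stable_def)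
    qed auto
  qed
  have "(\<Inter>p\<in>J. E p) = (\<Inter>i\<in>fst ` J. \<Inter>j\<in>J' i. E (i, j))"
    by (subst eq) auto
  also have "prob \<dots> = (\<Prod>i\<in>fst ` J. prob (\<Inter>j\<in>J' i. E (i, j)))"
    using J inA by (intro indep_setsD[OF indep sI]) auto
  also have "\<dots> = (\<Prod>i\<in>fst ` J. \<Prod>j\<in>J' i. prob (E (i, j)))"
  proof (rule prod.cong)
    fix i assume i: "i \<in> fst ` J"
    show "prob (\<Inter>j\<in>J' i. E (i, j)) = (\<Prod>j\<in>J' i. prob (E (i, j)))"
      using sI i by (intro indep_setsD[OF inner sK ne[OF i] fin]) (auto simp: J'_def E)
  qed simp
  also have "\<dots> = (\<Prod>p\<in>J. prob (E p))"
    using J(3) fin by (subst prod.Sigma) (auto simp: eq[symmetric] case_prod_unfold)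
  finally show "prob (\<Inter>p\<in>J. E p) = (\<Prod>p\<in>J. prob (E p))" .
qed

lemma (in prob_space) indep_set_nn_integral_mult:
  assumes sub: "subalgebra M F"
    and f: "f \<in> borel_measurable F"
    and X: "X \<in> borel_measurable M"
    and indep: "indep_set (sets F) {X -` B \<inter> space M |B. B \<in> sets borel}"
    and g: "g \<in> borel_measurable (borel :: real measure)"
  shows "(\<integral>\<^sup>+\<omega>. f \<omega> * (g (X \<omega>) :: ennreal) \<partial>M) = (\<integral>\<^sup>+\<omega>. f \<omega> \<partial>M) * (\<integral>\<^sup>+\<omega>. g (X \<omega>) \<partial>M)"
proof -
  have spF: "space F = space M" using sub by (simp add: subalgebra_def)
  let ?Z = "case_bool f (\<lambda>\<omega>. g (X \<omega>))"
  have f': "f \<in> borel_measurable M" using sub f by (rule measurable_from_subalg)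
  have "indep_vars (\<lambda>_. borel) ?Z UNIV"
    unfolding indep_vars_def2
  proof safe
    show "?Z b \<in> borel_measurable M" for b
      using f' measurable_compose[OF X g] by (cases b) auto
    show "indep_sets (\<lambda>b. {?Z b -` A \<inter> space M |A. A \<in> sets borel}) UNIV"
    proof (rule indep_sets_mono_sets[OF indep[unfolded indep_set_def]])
      fix b :: bool
      show "{?Z b -` A \<inter> space M |A. A \<in> sets borel}
          \<subseteq> (case b of True \<Rightarrow> sets F | False \<Rightarrow> {X -` B \<inter> space M |B. B \<in> sets borel})"
      proof (cases b)
        case True
        moreover have "f -` A \<inter> space M \<in> sets F" if "A \<in> sets borel" for A
          using measurable_sets[OF f that] by (simp add: spF)
        ultimately show ?thesis by simp blast
      next
        case False
        have "(\<lambda>\<omega>. g (X \<omega>)) -` A \<inter> space M = X -` (g -` A) \<inter> space M" for A by auto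
        moreover have "g -` A \<in> sets borel" if "A \<in> sets borel" for A
          using measurable_sets[OF g that] by simp
        ultimately show ?thesis using False by simp blast
      qed
    qed
  qed
  then have "(\<integral>\<^sup>+\<omega>. (\<Prod>b\<in>UNIV. ?Z b \<omega>) \<partial>M) = (\<Prod>b\<in>UNIV. \<integral>\<^sup>+\<omega>. ?Z b \<omega> \<partial>M)"
    by (intro indep_vars_nn_integral) auto
  then show ?thesis
    by (simp add: UNIV_bool mult.commute)
qed

section \<open>Maximal inequality and Gaussian increments\<close>

text \<open>Doob's maximal inequality for the submartingale \<open>exp (S j)\<close>, by induction on the number of steps:
  on the part of the event that has already occurred, the next factor is independent of the past and
  has mean at least \<open>1\<close>, so the integral over that part does not decrease; on the part that occurs
  for the first time, \<open>exp (S j)\<close> is at least \<open>exp a\<close>.\<close>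

lemma (in prob_space) exp_maximal_inequality:
  fixes S :: "nat \<Rightarrow> 'a \<Rightarrow> real" and F :: "nat \<Rightarrow> 'a measure"
  assumes sub: "\<And>j. subalgebra M (F j)"
    and mono: "\<And>i j. i \<le> j \<Longrightarrow> sets (F i) \<subseteq> sets (F j)"
    and S: "\<And>j. S j \<in> borel_measurable (F j)"
    and indep: "\<And>j. indep_set (sets (F j)) {(\<lambda>\<omega>. S (Suc j) \<omega> - S j \<omega>) -` B \<inter> space M |B. B \<in> sets borel}"
    and growth: "\<And>j. (\<integral>\<^sup>+\<omega>. ennreal (exp (S (Suc j) \<omega> - S j \<omega>)) \<partial>M) \<ge> 1"
  shows "ennreal (exp a) * emeasure M {\<omega>\<in>space M. \<exists>i\<le>m. a \<le> S i \<omega>}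
           \<le> (\<integral>\<^sup>+\<omega>. ennreal (exp (S m \<omega>)) \<partial>M)"
proof -
  define E where "E j = {\<omega>\<in>space M. \<exists>i\<le>j. a \<le> S i \<omega>}" for j
  have sp: "space (F j) = space M" for j using sub by (simp add: subalgebra_def)
  have SF: "S i \<in> borel_measurable (F j)" if "i \<le> j" for i j
    using S[of i] mono[OF that] sp by (auto simp: measurable_def)
  have SM[measurable]: "S i \<in> borel_measurable M" for i
    using measurable_from_subalg[OF sub S] .
  have EF: "E j \<in> sets (F j)" for j
  proof -
    have "E j = (\<Union>i\<le>j. S i -` {a..} \<inter> space (F j))" by (auto simp: E_def sp)
    also have "\<dots> \<in> sets (F j)"
      by (intro sets.finite_UN measurable_sets[OF SF]) auto
    finally show ?thesis .
  qed
  have EM[measurable]: "E j \<in> sets M" for j 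
    using EF sub by (auto simp: subalgebra_def)
  have main: "ennreal (exp a) * emeasure M (E j)
      \<le> (\<integral>\<^sup>+\<omega>. ennreal (exp (S j \<omega>)) * indicator (E j) \<omega> \<partial>M)" for j
  proof (induction j)
    case 0
    have "ennreal (exp a) * emeasure M (E 0) = (\<integral>\<^sup>+\<omega>. ennreal (exp a) * indicator (E 0) \<omega> \<partial>M)"
      by (simp add: nn_integral_cmult_indicator)
    also have "\<dots> \<le> (\<integral>\<^sup>+\<omega>. ennreal (exp (S 0 \<omega>)) * indicator (E 0) \<omega> \<partial>M)"
      by (intro nn_integral_mono) (auto simp: E_def split: split_indicator)
    finally show ?case .
  next
    case (Suc j)
    let ?new = "E (Suc j) - E j"
    have ge: "a \<le> S (Suc j) \<omega>" if "\<omega> \<in> ?new" for \<omega>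
      using that by (auto simp: E_def le_Suc_eq)
    have E_Suc: "E (Suc j) = E j \<union> ?new" by (auto simp: E_def intro: le_SucI)
    have "ennreal (exp a) * emeasure M (E j) \<le> (\<integral>\<^sup>+\<omega>. ennreal (exp (S j \<omega>)) * indicator (E j) \<omega> \<partial>M)"
      by (rule Suc.IH)
    also have "\<dots> = (\<integral>\<^sup>+\<omega>. ennreal (exp (S j \<omega>)) * indicator (E j) \<omega> \<partial>M) * 1" by simp
    also have "\<dots> \<le> (\<integral>\<^sup>+\<omega>. ennreal (exp (S j \<omega>)) * indicator (E j) \<omega> \<partial>M)
        * (\<integral>\<^sup>+\<omega>. ennreal (exp (S (Suc j) \<omega> - S j \<omega>)) \<partial>M)"
      by (intro mult_left_mono growth) simp
    also have "\<dots> = (\<integral>\<^sup>+\<omega>. ennreal (exp (S j \<omega>)) * indicator (E j) \<omega>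
        * ennreal (exp (S (Suc j) \<omega> - S j \<omega>)) \<partial>M)"
    proof (rule indep_set_nn_integral_mult[OF sub _ _ indep, where g = "\<lambda>x. ennreal (exp x)", symmetric])
      show "(\<lambda>\<omega>. ennreal (exp (S j \<omega>)) * indicator (E j) \<omega>) \<in> borel_measurable (F j)"
        by (intro borel_measurable_times_ennreal borel_measurable_indicator EF
              measurable_compose[OF S, where g = "\<lambda>x. ennreal (exp x)"]) simp
    qed auto
    also have "\<dots> = (\<integral>\<^sup>+\<omega>. ennreal (exp (S (Suc j) \<omega>)) * indicator (E j) \<omega> \<partial>M)"
      by (intro nn_integral_cong)
         (auto split: split_indicator simp: ennreal_mult[symmetric] exp_add[symmetric])
    finally have old: "ennreal (exp a) * emeasure M (E j)
        \<le> (\<integral>\<^sup>+\<omega>. ennreal (exp (S (Suc j) \<omega>)) * indicator (E j) \<omega> \<partial>M)" .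
    have "ennreal (exp a) * emeasure M ?new = (\<integral>\<^sup>+\<omega>. ennreal (exp a) * indicator ?new \<omega> \<partial>M)"
      by (subst nn_integral_cmult_indicator) auto
    also have "\<dots> \<le> (\<integral>\<^sup>+\<omega>. ennreal (exp (S (Suc j) \<omega>)) * indicator ?new \<omega> \<partial>M)"
      using ge by (intro nn_integral_mono) (auto split: split_indicator)
    finally have new: "ennreal (exp a) * emeasure M ?new
        \<le> (\<integral>\<^sup>+\<omega>. ennreal (exp (S (Suc j) \<omega>)) * indicator ?new \<omega> \<partial>M)" .
    have "emeasure M (E (Suc j)) = emeasure M (E j) + emeasure M ?new"
      by (subst E_Suc, rule plus_emeasure[symmetric]) auto
    then have "ennreal (exp a) * emeasure M (E (Suc j))
        = ennreal (exp a) * emeasure M (E j) + ennreal (exp a) * emeasure M ?new"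
      by (simp add: distrib_left)
    also have "\<dots> \<le> (\<integral>\<^sup>+\<omega>. ennreal (exp (S (Suc j) \<omega>)) * indicator (E j) \<omega> \<partial>M)
        + (\<integral>\<^sup>+\<omega>. ennreal (exp (S (Suc j) \<omega>)) * indicator ?new \<omega> \<partial>M)"
      by (intro add_mono old new)
    also have "\<dots> = (\<integral>\<^sup>+\<omega>. ennreal (exp (S (Suc j) \<omega>)) * indicator (E (Suc j)) \<omega> \<partial>M)"
      by (subst nn_integral_add[symmetric])
         (use E_Suc in \<open>auto intro!: nn_integral_cong split: split_indicator\<close>)
    finally show ?case .
  qed
  have "ennreal (exp a) * emeasure M (E m) \<le> (\<integral>\<^sup>+\<omega>. ennreal (exp (S m \<omega>)) * indicator (E m) \<omega> \<partial>M)"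
    by (rule main)
  also have "\<dots> \<le> (\<integral>\<^sup>+\<omega>. ennreal (exp (S m \<omega>)) \<partial>M)"
    by (intro nn_integral_mono) (auto split: split_indicator)
  finally show ?thesis unfolding E_def .
qed

lemma (in prob_space) nn_integral_exp_normal:
  assumes D: "distributed M lborel X (normal_density 0 \<sigma>)" and "\<sigma> > 0"
  shows "(\<integral>\<^sup>+\<omega>. ennreal (exp (l * X \<omega>)) \<partial>M) = ennreal (exp (l\<^sup>2 * \<sigma>\<^sup>2 / 2))"
proof -
  \<comment> \<open>Completing the square: the exponential tilt of a centred normal density is a multiple of the
    normal density with mean \<open>l * \<sigma>\<^sup>2\<close>.\<close>
  have sq: "normal_density 0 \<sigma> x * exp (l * x) = exp (l\<^sup>2 * \<sigma>\<^sup>2 / 2) * normal_density (l * \<sigma>\<^sup>2) \<sigma> x" for x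
  proof -
    have "- (x\<^sup>2) / (2 * \<sigma>\<^sup>2) + l * x = l\<^sup>2 * \<sigma>\<^sup>2 / 2 + - ((x - l * \<sigma>\<^sup>2)\<^sup>2) / (2 * \<sigma>\<^sup>2)"
      using \<open>\<sigma> > 0\<close> by (simp add: divide_simps, simp add: power2_eq_square power4_eq_xxxx algebra_simps)
    then have "exp (- (x\<^sup>2) / (2 * \<sigma>\<^sup>2)) * exp (l * x)
        = exp (l\<^sup>2 * \<sigma>\<^sup>2 / 2) * exp (- ((x - l * \<sigma>\<^sup>2)\<^sup>2) / (2 * \<sigma>\<^sup>2))"
      by (simp only: exp_add[symmetric])
    then show ?thesis
      by (simp add: normal_density_def)
  qed
  have "(\<integral>\<^sup>+\<omega>. ennreal (exp (l * X \<omega>)) \<partial>M)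
      = (\<integral>\<^sup>+x. ennreal (normal_density 0 \<sigma> x) * ennreal (exp (l * x)) \<partial>lborel)"
    by (rule distributed_nn_integral[OF D, symmetric]) simp
  also have "\<dots> = (\<integral>\<^sup>+x. ennreal (exp (l\<^sup>2 * \<sigma>\<^sup>2 / 2)) * ennreal (normal_density (l * \<sigma>\<^sup>2) \<sigma> x) \<partial>lborel)"
    by (intro nn_integral_cong) (simp add: ennreal_mult[symmetric] sq)
  also have "\<dots> = ennreal (exp (l\<^sup>2 * \<sigma>\<^sup>2 / 2)) * (\<integral>\<^sup>+x. ennreal (normal_density (l * \<sigma>\<^sup>2) \<sigma> x) \<partial>lborel)"
    by (rule nn_integral_cmult) simp
  also have "(\<integral>\<^sup>+x. ennreal (normal_density (l * \<sigma>\<^sup>2) \<sigma> x) \<partial>lborel) = 1"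
    using prob_space.emeasure_space_1[OF prob_space_normal_density[OF \<open>\<sigma> > 0\<close>, of "l * \<sigma>\<^sup>2"]]
    by (simp add: emeasure_density)
  finally show ?thesis by simp
qed

lemma Int_stable_sets: "Int_stable (sets K)"
  by (simp add: Int_stable_def sets.Int)

lemma Int_stable_vimage_sets: "Int_stable {X -` B \<inter> S |B. B \<in> sets K}"
proof (rule Int_stableI)
  fix a b assume "a \<in> {X -` B \<inter> S |B. B \<in> sets K}" "b \<in> {X -` B \<inter> S |B. B \<in> sets K}"
  then obtain A B where "a = X -` A \<inter> S" "b = X -` B \<inter> S" "A \<in> sets K" "B \<in> sets K"
    by blast
  then show "a \<inter> b \<in> {X -` B \<inter> S |B. B \<in> sets K}"
    by (intro CollectI exI[of _ "A \<inter> B"]) auto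
qed

text \<open>The definition of Brownian motion only provides independence of increments over finite grids. An
  event about the values at finitely many times up to \<open>s\<close> is an event about the increments over
  the grid of these times together with \<open>0\<close> and \<open>s\<close>, because the path starts at \<open>0\<close>; such events
  form an intersection-stable generator of the past.\<close>

lemma (in prob_space) brownian_increment_indep_past:
  assumes bm: "standard_brownian_motion M X" and st: "0 \<le> s" "s < t"
  shows "indep_set (sigma_sets (space M) {X r -` B \<inter> space M |r B. r \<in> {0..s} \<and> B \<in> sets borel})
           {(\<lambda>\<omega>. X t \<omega> - X s \<omega>) -` B \<inter> space M |B. B \<in> sets borel}"
proof -
  let ?G = "{X r -` B \<inter> space M |r B. r \<in> {0..s} \<and> B \<in> sets borel}"
  let ?C = "{(\<Inter>r\<in>F. X r -` B r) \<inter> space M |F B. finite F \<and> F \<subseteq> {0..s} \<and> (\<forall>r\<in>F. B r \<in> sets borel)}"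
  let ?D = "{(\<lambda>\<omega>. X t \<omega> - X s \<omega>) -` B \<inter> space M |B. B \<in> sets borel}"
  have X[measurable]: "X r \<in> borel_measurable M" if "0 \<le> r" for r
    using bm that by (auto simp: standard_brownian_motion_def)
  have X0: "X 0 \<omega> = 0" if "\<omega> \<in> space M" for \<omega>
    using bm that by (auto simp: standard_brownian_motion_def)
  have C_event: "(\<Inter>r\<in>F. X r -` B r) \<inter> space M \<in> events"
    if "finite F" "F \<subseteq> {0..s}" "\<forall>r\<in>F. B r \<in> sets borel" for F and B :: "real \<Rightarrow> real set"
  proof -
    have "{\<omega>\<in>space M. \<forall>r\<in>F. X r \<omega> \<in> B r} \<in> events"
      using that by (intro sets.sets_Collect_finite_All) (auto intro!: measurable_sets_borel predE)
    also have "{\<omega>\<in>space M. \<forall>r\<in>F. X r \<omega> \<in> B r} = (\<Inter>r\<in>F. X r -` B r) \<inter> space M" by auto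
    finally show ?thesis .
  qed
  have stable: "Int_stable ?C"
  proof (rule Int_stableI)
    fix a b assume "a \<in> ?C" "b \<in> ?C"
    then obtain F A F' A' where a: "a = (\<Inter>r\<in>F. X r -` A r) \<inter> space M" "finite F" "F \<subseteq> {0..s}" "\<forall>r\<in>F. A r \<in> sets borel"
      and b: "b = (\<Inter>r\<in>F'. X r -` A' r) \<inter> space M" "finite F'" "F' \<subseteq> {0..s}" "\<forall>r\<in>F'. A' r \<in> sets borel"
      by blast
    let ?B = "\<lambda>r. (if r \<in> F then A r else UNIV) \<inter> (if r \<in> F' then A' r else UNIV)"
    have "a \<inter> b = (\<Inter>r\<in>F \<union> F'. X r -` ?B r) \<inter> space M"
      unfolding a b by (auto split: if_splits)
    moreover have "\<forall>r\<in>F \<union> F'. ?B r \<in> sets borel" using a b by auto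
    ultimately show "a \<inter> b \<in> ?C" using a b
      by (intro CollectI exI[of _ "F \<union> F'"] exI[of _ ?B]) auto
  qed
  have D_stable: "Int_stable ?D" by (rule Int_stable_vimage_sets)
  have "indep_set ?C ?D"
  proof (rule indep_setI)
    show "?C \<subseteq> events" using C_event by blast
    show "?D \<subseteq> events" using st by (auto intro!: measurable_sets_borel[of _ M])
  next
    fix c d assume "c \<in> ?C" "d \<in> ?D"
    then obtain F A B where c: "c = (\<Inter>r\<in>F. X r -` A r) \<inter> space M" "finite F" "F \<subseteq> {0..s}" "\<forall>r\<in>F. A r \<in> sets borel"
      and d: "d = (\<lambda>\<omega>. X t \<omega> - X s \<omega>) -` B \<inter> space M" "B \<in> sets borel" by blast
    \<comment> \<open>The grid: the times involved together with \<open>0\<close> and \<open>s\<close>, in increasing order, and finally \<open>t\<close>.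
      Its last increment is the one from \<open>s\<close> to \<open>t\<close>.\<close>
    have fin: "finite (insert 0 (insert s F))" using c by simp
    then obtain xs where xs: "sorted_wrt (<) xs" "set xs = insert 0 (insert s F)"
      using strict_sorted_list_of_set set_sorted_list_of_set by blast
    define k where "k = length xs - 1"
    have len: "length xs = Suc k" using xs(2) by (cases xs) (auto simp: k_def)
    define ts where "ts i = (if i \<le> k then xs ! i else t)" for i
    have in_s: "xs ! i \<in> {0..s}" if "i \<le> k" for i
      using nth_mem[of i xs] that len xs(2) c(3) st by auto
    have mono: "ts i < ts j" if "i < j" "j \<le> Suc k" for i j
      using sorted_wrt_nth_less[OF xs(1), of i j] that len in_s[of i] st
      by (auto simp: ts_def)
    have idx: "\<exists>i\<le>k. ts i = r" if "r \<in> insert 0 (insert s F)" for r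
      using that len xs(2) unfolding ts_def by (metis in_set_conv_nth less_Suc_eq_le)
    have ts0: "ts 0 = 0"
    proof -
      obtain i where i: "i \<le> k" "ts i = 0" using idx[of 0] by auto
      have "0 \<le> ts 0" using in_s[of 0] by (simp add: ts_def)
      then show ?thesis using mono[of 0 i] i by (cases "i = 0") auto
    qed
    have tsk: "ts k = s"
    proof -
      obtain i where i: "i \<le> k" "ts i = s" using idx[of s] by auto
      have "ts k \<le> s" using in_s[of k] by (simp add: ts_def)
      then show ?thesis using mono[of i k] i by (cases "i = k") auto
    qed
    have tst: "ts (Suc k) = t" by (simp add: ts_def)
    define I where "I i \<omega> = X (ts (Suc i)) \<omega> - X (ts i) \<omega>" for i \<omega>
    have iv: "indep_vars (\<lambda>_. borel) I {..<Suc k}"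
      using bm mono ts0 unfolding standard_brownian_motion_def I_def[abs_def]
      by (elim conjE allE[of _ ts] allE[of _ "Suc k"]) auto
    have "indep_var (PiM {..<k} (\<lambda>_. borel)) (\<lambda>\<omega>. restrict (\<lambda>i. I i \<omega>) {..<k})
        (PiM {k} (\<lambda>_. borel)) (\<lambda>\<omega>. restrict (\<lambda>i. I i \<omega>) {k})"
      by (rule indep_var_restrict[OF iv]) auto
    from indep_varD[OF this]
    have indep: "prob ((\<lambda>\<omega>. (restrict (\<lambda>i. I i \<omega>) {..<k}, restrict (\<lambda>i. I i \<omega>) {k})) -` (Xa \<times> Xb) \<inter> space M)
       = prob ((\<lambda>\<omega>. restrict (\<lambda>i. I i \<omega>) {..<k}) -` Xa \<inter> space M)
        * prob ((\<lambda>\<omega>. restrict (\<lambda>i. I i \<omega>) {k}) -` Xb \<inter> space M)"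
      if "Xa \<in> sets (PiM {..<k} (\<lambda>_. borel))" "Xb \<in> sets (PiM {k} (\<lambda>_. borel))" for Xa Xb
      using that by blast
    have tele: "X (ts i) \<omega> = (\<Sum>j<i. restrict (\<lambda>i. I i \<omega>) {..<k} j)" if "i \<le> k" "\<omega> \<in> space M" for i \<omega>
      using that(1)
    proof (induction i)
      case 0 then show ?case using X0[OF that(2)] by (simp add: ts0)
    next
      case (Suc i) then show ?case by (simp add: I_def)
    qed
    define Xa where "Xa = {v \<in> space (PiM {..<k} (\<lambda>_. borel :: real measure)).
       \<forall>i\<in>{i. i \<le> k \<and> ts i \<in> F}. (\<Sum>j<i. v j) \<in> A (ts i)}"
    define Xb where "Xb = {v \<in> space (PiM {k} (\<lambda>_. borel :: real measure)). v k \<in> B}"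
    have Xa: "Xa \<in> sets (PiM {..<k} (\<lambda>_. borel))" unfolding Xa_def
    proof (rule sets.sets_Collect_finite_All)
      show "finite {i. i \<le> k \<and> ts i \<in> F}" by simp
      fix i assume i: "i \<in> {i. i \<le> k \<and> ts i \<in> F}"
      have "(\<lambda>v. \<Sum>j<i. v j) \<in> borel_measurable (PiM {..<k} (\<lambda>_. borel :: real measure))"
        using i by (intro borel_measurable_sum measurable_component_singleton) auto
      moreover have "A (ts i) \<in> sets borel" using i c by auto
      ultimately show "{v \<in> space (PiM {..<k} (\<lambda>_. borel :: real measure)). (\<Sum>j<i. v j) \<in> A (ts i)} \<in> sets (PiM {..<k} (\<lambda>_. borel))"
        using measurable_sets by (fastforce simp: vimage_def Int_def conj_commute)
    qed
    have Xb: "Xb \<in> sets (PiM {k} (\<lambda>_. borel))"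
      unfolding Xb_def using d(2) by measurable
    have c_eq: "c = (\<lambda>\<omega>. restrict (\<lambda>i. I i \<omega>) {..<k}) -` Xa \<inter> space M"
    proof (intro set_eqI)
      fix \<omega>
      show "\<omega> \<in> c \<longleftrightarrow> \<omega> \<in> (\<lambda>\<omega>. restrict (\<lambda>i. I i \<omega>) {..<k}) -` Xa \<inter> space M"
      proof (cases "\<omega> \<in> space M")
        case True
        have "\<omega> \<in> c \<longleftrightarrow> (\<forall>r\<in>F. X r \<omega> \<in> A r)" using True by (auto simp: c)
        also have "\<dots> \<longleftrightarrow> (\<forall>i\<in>{i. i \<le> k \<and> ts i \<in> F}. X (ts i) \<omega> \<in> A (ts i))"
          using idx by force
        also have "\<dots> \<longleftrightarrow> restrict (\<lambda>i. I i \<omega>) {..<k} \<in> Xa"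
          using tele[OF _ True] by (auto simp: Xa_def space_PiM)
        finally show ?thesis using True by simp
      qed (simp add: c)
    qed
    have d_eq: "d = (\<lambda>\<omega>. restrict (\<lambda>i. I i \<omega>) {k}) -` Xb \<inter> space M"
      by (auto simp: d Xb_def space_PiM I_def tst tsk)
    have "c \<inter> d = (\<lambda>\<omega>. (restrict (\<lambda>i. I i \<omega>) {..<k}, restrict (\<lambda>i. I i \<omega>) {k})) -` (Xa \<times> Xb) \<inter> space M"
      unfolding c_eq d_eq by auto
    then show "prob (c \<inter> d) = prob c * prob d"
      using indep[OF Xa Xb] unfolding c_eq d_eq by simp
  qed
  from indep_set_sigma_sets[OF this stable D_stable]
  have "indep_set (sigma_sets (space M) ?C) (sigma_sets (space M) ?D)" .
  moreover have "sigma_sets (space M) ?G \<subseteq> sigma_sets (space M) ?C"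
  proof (rule sigma_sets_mono')
    show "?G \<subseteq> ?C"
    proof
      fix g assume "g \<in> ?G"
      then obtain r B where "g = X r -` B \<inter> space M" "r \<in> {0..s}" "B \<in> sets borel" by blast
      then show "g \<in> ?C" by (intro CollectI exI[of _ "{r}"] exI[of _ "\<lambda>_. B"]) auto
    qed
  qed
  ultimately show ?thesis
    unfolding indep_set_def
    by (elim indep_sets_mono_sets) (auto split: bool.splits)
qed

section \<open>The noise of an honest group\<close>

locale sensor_network =
  fixes M :: "'a measure" and R :: "'r measure" and N :: nat
    and W :: "nat \<Rightarrow> real \<Rightarrow> 'a \<Rightarrow> real" and U :: "'a \<Rightarrow> 'r"
  assumes noise: "sensor_noise M R N W U"
begin

sublocale prob_space M
  using noise by (simp add: sensor_noise_def)

text \<open>What the sensors outside \<open>C\<close> and the randomisation contribute is known for all times, the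
  sensors in \<open>C\<close> only up to time \<open>s\<close>. When the compromised sensor lies outside \<open>C\<close>, this contains every
  report made up to time \<open>s\<close>, even if the attack anticipates the future of its own signal.\<close>

definition past :: "nat set \<Rightarrow> real \<Rightarrow> 'a measure" where
  "past C s = sigma (space M)
     ({W n r -` B \<inter> space M |n r B. n \<in> {1..N} \<and> 0 \<le> r \<and> (n \<in> C \<longrightarrow> r \<le> s) \<and> B \<in> sets borel}
      \<union> {U -` B \<inter> space M |B. B \<in> sets R})"

definition total_noise :: "nat set \<Rightarrow> real \<Rightarrow> 'a \<Rightarrow> real" where
  "total_noise C t \<omega> = (\<Sum>n\<in>C. W n t \<omega>)"

lemma brownian: "n \<in> {1..N} \<Longrightarrow> standard_brownian_motion M (W n)"
  using noise by (auto simp: sensor_noise_def)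

lemma measurable_W: "n \<in> {1..N} \<Longrightarrow> 0 \<le> t \<Longrightarrow> W n t \<in> borel_measurable M"
  using brownian by (auto simp: standard_brownian_motion_def)

lemma measurable_U: "U \<in> M \<rightarrow>\<^sub>M R"
  using noise by (simp add: sensor_noise_def)

lemma indep_paths: "indep_vars (\<lambda>_. path_space) (\<lambda>n. sample_path (W n)) {1..N}"
  using noise by (simp add: sensor_noise_def)

lemma measurable_total_noise:
  "C \<subseteq> {1..N} \<Longrightarrow> 0 \<le> t \<Longrightarrow> total_noise C t \<in> borel_measurable M"
  unfolding total_noise_def[abs_def] by (intro borel_measurable_sum measurable_W) auto

lemma sets_past:
  "sets (past C s) = sigma_sets (space M)
     ({W n r -` B \<inter> space M |n r B. n \<in> {1..N} \<and> 0 \<le> r \<and> (n \<in> C \<longrightarrow> r \<le> s) \<and> B \<in> sets borel}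
      \<union> {U -` B \<inter> space M |B. B \<in> sets R})"
  unfolding past_def by (rule sets_measure_of) auto

lemma space_past[simp]: "space (past C s) = space M"
  unfolding past_def by (rule space_measure_of) auto

lemma past_subalgebra: "subalgebra M (past C s)"
proof -
  have "sets (past C s) \<subseteq> events"
    unfolding sets_past
    by (rule sets.sigma_sets_subset)
       (use measurable_sets[OF measurable_W] measurable_sets[OF measurable_U] in blast)
  then show ?thesis by (simp add: subalgebra_def)
qed

lemma past_mono: "s \<le> t \<Longrightarrow> sets (past C s) \<subseteq> sets (past C t)"
  unfolding sets_past
  by (rule sigma_sets_mono', intro Un_mono order_refl Collect_mono)
     (intro impI, elim exE conjE, intro exI conjI, assumption+, auto)

lemma measurable_past:
  assumes "n \<in> {1..N}" "0 \<le> r" "n \<in> C \<Longrightarrow> r \<le> s"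
  shows "W n r \<in> borel_measurable (past C s)"
proof (rule measurableI)
  fix B :: "real set" assume "B \<in> sets borel"
  then show "W n r -` B \<inter> space (past C s) \<in> sets (past C s)"
    unfolding sets_past space_past using assms by (intro sigma_sets.Basic) auto
qed auto

lemma measurable_past_U: "U \<in> past C s \<rightarrow>\<^sub>M R"
proof (rule measurableI)
  fix B assume "B \<in> sets R"
  then show "U -` B \<inter> space (past C s) \<in> sets (past C s)"
    unfolding sets_past space_past by (intro sigma_sets.Basic) auto
qed (use measurable_space[OF measurable_U] in auto)

text \<open>Split each sensor of \<open>C\<close> into its path up to time \<open>s\<close> and its increment after \<open>s\<close>; all these
  pieces, the complete paths of the other sensors and the randomisation are jointly independent. The
  past is generated by all pieces except the increments.\<close>

lemma increment_indep_past:
  assumes C: "C \<subseteq> {1..N}" and st: "0 \<le> s" "s < t"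
  shows "indep_set (sets (past C s))
           {(\<lambda>\<omega>. total_noise C t \<omega> - total_noise C s \<omega>) -` B \<inter> space M |B. B \<in> sets borel}"
proof -
  define Q where "Q n = vimage_algebra (space M) (sample_path (W n)) path_space" for n
  define V where "V = vimage_algebra (space M) U R"
  define J where "J = vimage_algebra (space M) (\<lambda>\<omega>. \<lambda>n\<in>{1..N}. sample_path (W n) \<omega>) (PiM {1..N} (\<lambda>_. path_space))"
  have path_sp: "sample_path (W n) \<omega> \<in> space path_space" for n \<omega>
    by (auto simp: sample_path_def space_PiM)
  have joint_sp: "(\<lambda>\<omega>. \<lambda>n\<in>{1..N}. sample_path (W n) \<omega>) \<in> space M \<rightarrow> space (PiM {1..N} (\<lambda>_. path_space))"
    using path_sp by (auto simp: space_PiM)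
  have UV: "indep_set (sets V) (sets J)"
    using noise by (simp add: sensor_noise_def V_def J_def)
  have QW: "W n r \<in> borel_measurable (Q n)" if "0 \<le> r" for n r
  proof -
    have 1: "sample_path (W n) \<in> Q n \<rightarrow>\<^sub>M path_space"
      unfolding Q_def using path_sp by (intro measurable_vimage_algebra1) auto
    have "(\<lambda>\<omega>. sample_path (W n) \<omega> r) \<in> borel_measurable (Q n)"
      using that by (intro measurable_compose[OF 1] measurable_component_singleton) auto
    then show ?thesis using that by (simp add: sample_path_def)
  qed
  have spQ: "space (Q n) = space M" for n by (simp add: Q_def)
  have spJ: "space J = space M" by (simp add: J_def)
  have Q_J: "sets (Q n) \<subseteq> sets J" if n: "n \<in> {1..N}" for n
  proof -
    have 1: "(\<lambda>\<omega>. \<lambda>n\<in>{1..N}. sample_path (W n) \<omega>) \<in> J \<rightarrow>\<^sub>M PiM {1..N} (\<lambda>_. path_space)"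
      unfolding J_def using joint_sp by (rule measurable_vimage_algebra1)
    have "(\<lambda>\<omega>. (\<lambda>n\<in>{1..N}. sample_path (W n) \<omega>) n) \<in> J \<rightarrow>\<^sub>M path_space"
      using n by (intro measurable_compose[OF 1] measurable_component_singleton) auto
    then have "sample_path (W n) \<in> J \<rightarrow>\<^sub>M path_space" using n by simp
    then have "sample_path (W n) -` A \<inter> space M \<in> sets J" if "A \<in> sets path_space" for A
      using measurable_sets[OF _ that, of "sample_path (W n)" J] by (simp only: spJ)
    then have "{sample_path (W n) -` A \<inter> space M |A. A \<in> sets path_space} \<subseteq> sets J" by blast
    from sets.sigma_sets_subset[OF this] show ?thesis
      unfolding Q_def sets_vimage_algebra by (simp only: spJ)
  qed
  have Q_indep: "indep_sets (\<lambda>n. sets (Q n)) {1..N}"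
    using indep_paths by (simp add: indep_vars_def Q_def sets_vimage_algebra)
  have V_events: "sets V \<subseteq> events"
    using UV by (auto simp: indep_sets2_eq)
  \<comment> \<open>The index \<open>(True, 0)\<close> stands for the randomisation, \<open>(False, n)\<close> for sensor \<open>n\<close>.\<close>
  define L where "L = (SIGMA b:UNIV. if b then {0::nat} else {1..N})"
  define A where "A = (\<lambda>(b, n). if b then sets V else sets (Q n))"
  have A_indep: "indep_sets A L"
  proof -
    have "indep_sets (\<lambda>(b, n). if b then sets V else sets (Q n)) L"
      unfolding L_def
    proof (rule indep_sets_refine[OF UV[unfolded indep_set_def]])
      fix b :: bool
      show "Int_stable (case b of True \<Rightarrow> sets V | False \<Rightarrow> sets J)"
        by (cases b) (simp_all add: Int_stable_sets)
      show "indep_sets (\<lambda>n. if b then sets V else sets (Q n)) (if b then {0} else {1..N})"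
        using Q_indep V_events by (cases b) (auto intro!: indep_setsI simp: subset_singleton_iff)
      show "(if b then sets V else sets (Q n)) \<subseteq> (case b of True \<Rightarrow> sets V | False \<Rightarrow> sets J)"
        if "n \<in> (if b then {0} else {1..N})" for n
        using that Q_J by (cases b) auto
    qed
    then show ?thesis by (simp add: A_def)
  qed
  \<comment> \<open>Every index gets a past and a future part. Where nothing is hidden, the past part is everything
    and the future part is trivial.\<close>
  define pre where "pre = (\<lambda>(b, n). if b then sets V else if n \<in> C
      then sigma_sets (space M) {W n r -` B \<inter> space M |r B. r \<in> {0..s} \<and> B \<in> sets borel}
      else sets (Q n))"
  define fut where "fut = (\<lambda>(b, n). if \<not> b \<and> n \<in> C
      then {(\<lambda>\<omega>. W n t \<omega> - W n s \<omega>) -` B \<inter> space M |B. B \<in> sets borel} else {space M})"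
  have A_events: "A p \<subseteq> events" if "p \<in> L" for p
    using A_indep that by (auto simp: indep_sets_def)
  have fut_stable: "Int_stable (fut p)" for p
  proof (cases p)
    case (Pair b n)
    show ?thesis
      using Int_stable_vimage_sets[of "\<lambda>\<omega>. W n t \<omega> - W n s \<omega>" "space M" borel]
      by (simp add: Pair fut_def) (simp add: Int_stable_def)
  qed
  have pre_stable: "Int_stable (pre p)" for p
  proof (cases p)
    case (Pair b n)
    let ?G = "{W n r -` B \<inter> space M |r B. r \<in> {0..s} \<and> B \<in> sets borel}"
    have "sets (sigma (space M) ?G) = sigma_sets (space M) ?G"
      by (rule sets_measure_of) auto
    then have "pre p = sets (if b then V else if n \<in> C then sigma (space M) ?G else Q n)"
      by (simp add: Pair pre_def)
    then show ?thesis by (simp only: Int_stable_sets)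
  qed
  have pre_A: "pre p \<subseteq> A p" for p
  proof (cases p)
    case (Pair b n)
    have "sigma_sets (space (Q n)) {W n r -` B \<inter> space (Q n) |r B. r \<in> {0..s} \<and> B \<in> sets borel} \<subseteq> sets (Q n)"
      by (rule sets.sigma_sets_subset) (use measurable_sets[OF QW] in auto)
    then show ?thesis by (auto simp: Pair pre_def A_def spQ)
  qed
  have fut_A: "fut p \<subseteq> A p" for p
  proof (cases p)
    case (Pair b n)
    have "(\<lambda>\<omega>. W n t \<omega> - W n s \<omega>) \<in> borel_measurable (Q n)"
      using st by (intro borel_measurable_diff QW) auto
    from measurable_sets[OF this]
    have "{(\<lambda>\<omega>. W n t \<omega> - W n s \<omega>) -` B \<inter> space M |B. B \<in> sets borel} \<subseteq> sets (Q n)"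
      by (auto simp: spQ)
    moreover have "space M \<in> sets V" "space M \<in> sets (Q n)"
      using sets.top[of V] sets.top[of "Q n"] by (simp_all add: V_def Q_def)
    ultimately show ?thesis by (auto simp: Pair fut_def A_def)
  qed
  have inner: "indep_sets (case_bool (pre p) (fut p)) UNIV" if p: "p \<in> L" for p
  proof (cases p)
    case (Pair b n)
    have "indep_set (pre p) (fut p)"
    proof (cases "\<not> b \<and> n \<in> C")
      case True
      then have "standard_brownian_motion M (W n)" using C brownian by auto
      from brownian_increment_indep_past[OF this st] True show ?thesis
        by (simp add: Pair pre_def fut_def)
    next
      case False
      then have "fut p = {space M}" by (auto simp: Pair fut_def)
      moreover have "pre p \<subseteq> events" using pre_A A_events[OF p] by blast
      ultimately show ?thesis
        using sets.sets_into_space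
        by (intro indep_setI) (auto simp: prob_space Int_absorb2)
    qed
    then show ?thesis by (simp add: indep_set_def)
  qed
  let ?E = "\<lambda>(p, c). case_bool (pre p) (fut p) c"
  have "indep_sets ?E (SIGMA p:L. UNIV)"
  proof (rule indep_sets_refine[OF A_indep])
    show "Int_stable (A p)" for p by (cases p) (simp add: A_def Int_stable_sets)
    show "case_bool (pre p) (fut p) c \<subseteq> A p" for p c
      using pre_A fut_A by (cases c) auto
  qed (rule inner)
  also have "(SIGMA p:L. UNIV) = (\<Union>c\<in>UNIV. L \<times> {c})" by auto
  finally have indep: "indep_sets (\<lambda>c. sigma_sets (space M) (\<Union>i\<in>L \<times> {c}. ?E i)) UNIV"
  proof (rule indep_sets_collect_sigma[where I = "\<lambda>c. L \<times> {c}" and E = ?E])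
    show "Int_stable (?E i)" for i
      using pre_stable fut_stable by (cases i, cases "snd i") auto
  qed (auto simp: disjoint_family_on_def)
  have in_L: "(False, n) \<in> L" if "n \<in> {1..N}" for n using that by (auto simp: L_def)
  let ?D = "{(\<lambda>\<omega>. total_noise C t \<omega> - total_noise C s \<omega>) -` B \<inter> space M |B. B \<in> sets borel}"
  have past_sub: "sets (past C s) \<subseteq> sigma_sets (space M) (\<Union>i\<in>L \<times> {True}. ?E i)" (is "_ \<subseteq> ?S")
    unfolding sets_past
  proof (rule sigma_sets_mono, intro Un_least subsetI)
    fix x
    assume "x \<in> {W n r -` B \<inter> space M |n r B.
        n \<in> {1..N} \<and> 0 \<le> r \<and> (n \<in> C \<longrightarrow> r \<le> s) \<and> B \<in> sets borel}"
    then obtain n r B where x: "x = W n r -` B \<inter> space M"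
      and n: "n \<in> {1..N}" and r: "0 \<le> r" "n \<in> C \<longrightarrow> r \<le> s" and B: "B \<in> sets borel"
      by blast
    have "W n r -` B \<inter> space M \<in> pre (False, n)"
    proof (cases "n \<in> C")
      case True
      then show ?thesis using r B by (auto simp: pre_def intro!: sigma_sets.Basic)
    next
      case False
      then show ?thesis using measurable_sets[OF QW[OF r(1)] B] by (simp add: pre_def spQ)
    qed
    then show "x \<in> ?S"
      unfolding x using in_L[OF n] by (intro sigma_sets.Basic UN_I[of "((False, n), True)"]) auto
  next
    fix x assume "x \<in> {U -` B \<inter> space M |B. B \<in> sets R}"
    then have "x \<in> sets V"
      unfolding V_def by (auto intro: in_vimage_algebra)
    then show "x \<in> ?S"
      by (intro sigma_sets.Basic UN_I[of "((True, 0), True)"]) (auto simp: pre_def L_def)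
  qed
  have fut_sub: "?D \<subseteq> sigma_sets (space M) (\<Union>i\<in>L \<times> {False}. ?E i)" (is "_ \<subseteq> ?S'")
  proof -
    define Z where "Z = sigma (space M) (\<Union>i\<in>L \<times> {False}. ?E i)"
    have "(\<Union>i\<in>L \<times> {False}. ?E i) \<subseteq> Pow (space M)"
    proof
      fix x assume "x \<in> (\<Union>i\<in>L \<times> {False}. ?E i)"
      then obtain p where "p \<in> L" "x \<in> fut p" by auto
      then have "x \<in> events" using fut_A A_events by blast
      then show "x \<in> Pow (space M)" using sets.sets_into_space by blast
    qed
    then have Z: "sets Z = ?S'" "space Z = space M" by (simp_all add: Z_def)
    have "(\<lambda>\<omega>. W n t \<omega> - W n s \<omega>) \<in> borel_measurable Z" if "n \<in> C" for n
    proof (rule measurableI)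
      fix B :: "real set" assume "B \<in> sets borel"
      then have "(\<lambda>\<omega>. W n t \<omega> - W n s \<omega>) -` B \<inter> space M \<in> fut (False, n)"
        using that by (auto simp: fut_def)
      then show "(\<lambda>\<omega>. W n t \<omega> - W n s \<omega>) -` B \<inter> space Z \<in> sets Z"
        unfolding Z using in_L[of n] C that
        by (intro sigma_sets.Basic UN_I[of "((False, n), False)"]) auto
    qed auto
    then have "(\<lambda>\<omega>. \<Sum>n\<in>C. W n t \<omega> - W n s \<omega>) \<in> borel_measurable Z"
      by (intro borel_measurable_sum)
    then have "(\<lambda>\<omega>. total_noise C t \<omega> - total_noise C s \<omega>) \<in> borel_measurable Z"
      by (simp add: total_noise_def sum_subtractf)
    from measurable_sets[OF this] show ?thesis unfolding Z by auto
  qed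
  show ?thesis
    unfolding indep_set_def
    by (rule indep_sets_mono_sets[OF indep]) (use past_sub fut_sub in \<open>auto split: bool.splits\<close>)
qed

lemma nn_integral_exp_increment:
  assumes C: "C \<subseteq> {1..N}" and st: "0 \<le> s" "s < t"
  shows "(\<integral>\<^sup>+\<omega>. ennreal (exp (l * (total_noise C t \<omega> - total_noise C s \<omega>))) \<partial>M)
           = ennreal (exp (l\<^sup>2 * real (card C) * (t - s) / 2))"
proof -
  have fin: "finite C" using C by (rule finite_subset) simp
  have "indep_vars (\<lambda>_. borel) (\<lambda>n \<omega>. (\<lambda>x. ennreal (exp (l * (x t - x s)))) (sample_path (W n) \<omega>)) C"
  proof (rule indep_vars_compose2[OF indep_vars_subset[OF indep_paths C]])
    have "(\<lambda>x. x r) \<in> path_space \<rightarrow>\<^sub>M borel" if "0 \<le> r" for r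
      using that by (intro measurable_component_singleton) auto
    from this[of s] this[of t] st
    show "(\<lambda>x. ennreal (exp (l * (x t - x s)))) \<in> borel_measurable path_space" by simp
  qed
  moreover have "(\<lambda>x. ennreal (exp (l * (x t - x s)))) (sample_path (W n) \<omega>)
      = ennreal (exp (l * (W n t \<omega> - W n s \<omega>)))" for n \<omega>
    using st by (simp add: sample_path_def)
  ultimately have iv: "indep_vars (\<lambda>_. borel) (\<lambda>n \<omega>. ennreal (exp (l * (W n t \<omega> - W n s \<omega>)))) C"
    by simp
  have "(\<integral>\<^sup>+\<omega>. ennreal (exp (l * (total_noise C t \<omega> - total_noise C s \<omega>))) \<partial>M)
      = (\<integral>\<^sup>+\<omega>. (\<Prod>n\<in>C. ennreal (exp (l * (W n t \<omega> - W n s \<omega>)))) \<partial>M)"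
  proof (rule nn_integral_cong)
    fix \<omega>
    have "l * (total_noise C t \<omega> - total_noise C s \<omega>) = (\<Sum>n\<in>C. l * (W n t \<omega> - W n s \<omega>))"
      by (simp add: total_noise_def sum_subtractf sum_distrib_left right_diff_distrib)
    then show "ennreal (exp (l * (total_noise C t \<omega> - total_noise C s \<omega>)))
        = (\<Prod>n\<in>C. ennreal (exp (l * (W n t \<omega> - W n s \<omega>))))"
      by (simp only: exp_sum[OF fin] prod_ennreal exp_ge_zero)
  qed
  also have "\<dots> = (\<Prod>n\<in>C. \<integral>\<^sup>+\<omega>. ennreal (exp (l * (W n t \<omega> - W n s \<omega>))) \<partial>M)"
    by (rule indep_vars_nn_integral[OF fin iv]) simp
  also have "\<dots> = (\<Prod>n\<in>C. ennreal (exp (l\<^sup>2 * (t - s) / 2)))"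
  proof (rule prod.cong)
    fix n assume "n \<in> C"
    then have "standard_brownian_motion M (W n)" using C brownian by auto
    then have "distributed M lborel (\<lambda>\<omega>. W n t \<omega> - W n s \<omega>) (normal_density 0 (sqrt (t - s)))"
      using st by (simp add: standard_brownian_motion_def)
    from nn_integral_exp_normal[OF this, of l] st
    show "(\<integral>\<^sup>+\<omega>. ennreal (exp (l * (W n t \<omega> - W n s \<omega>))) \<partial>M) = ennreal (exp (l\<^sup>2 * (t - s) / 2))"
      by simp
  qed simp
  also have "\<dots> = ennreal (exp (l\<^sup>2 * real (card C) * (t - s) / 2))"
  proof -
    have "exp (l\<^sup>2 * (t - s) / 2) ^ card C = exp (real (card C) * (l\<^sup>2 * (t - s) / 2))"
      by (rule exp_of_nat_mult[symmetric])
    also have "real (card C) * (l\<^sup>2 * (t - s) / 2) = l\<^sup>2 * real (card C) * (t - s) / 2" by simp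
    finally show ?thesis by (simp add: ennreal_power)
  qed
  finally show ?thesis .
qed

lemma measurable_past_total_noise:
  assumes "C \<subseteq> {1..N}" "0 \<le> r" "r \<le> s"
  shows "total_noise C r \<in> borel_measurable (past C s)"
  unfolding total_noise_def[abs_def] using assms by (intro borel_measurable_sum measurable_past) auto

lemma total_noise_continuous:
  assumes "C \<subseteq> {1..N}" "\<omega> \<in> space M"
  shows "continuous_on {0..} (\<lambda>t. total_noise C t \<omega>)"
proof -
  have "continuous_on {0..} (\<lambda>t. W n t \<omega>)" if "n \<in> C" for n
    using brownian[of n] that assms by (auto simp: standard_brownian_motion_def)
  then show ?thesis unfolding total_noise_def by (intro continuous_on_sum)
qed

text \<open>The mean of \<open>exp (l * B + d * t)\<close> is \<open>exp (c * t)\<close> with \<open>c \<ge> 0\<close>, so the discrete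
  maximal inequality applies on every dyadic grid with the same bound. The exceptional
  events increase with the grid, and continuity of the paths extends the estimate from dyadic times
  to all times.\<close>

lemma drifted_noise_maximal_inequality:
  assumes C: "C \<subseteq> {1..N}" and s: "0 \<le> s" and L: "0 < L"
    and c: "c = l\<^sup>2 * real (card C) / 2 + d" "0 \<le> c"
  shows "\<exists>A\<in>events. prob A \<le> exp (c * L - a) \<and>
    (\<forall>\<omega>\<in>space M - A. \<forall>t\<in>{s..s + L}. l * (total_noise C t \<omega> - total_noise C s \<omega>) + d * (t - s) \<le> a)"
proof -
  define Y where "Y t \<omega> = l * (total_noise C t \<omega> - total_noise C s \<omega>) + d * (t - s)" for t \<omega>
  define g where "g n i = s + L * real i / 2 ^ n" for n i :: nat
  define A where "A n = {\<omega>\<in>space M. \<exists>i\<le>2 ^ n. a \<le> Y (g n i) \<omega>}" for n :: nat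
  have g_ge: "s \<le> g n i" for n i using L by (simp add: g_def)
  have g0: "0 \<le> g n i" for n i using g_ge[of n i] s by linarith
  have g_mono: "i \<le> j \<Longrightarrow> g n i \<le> g n j" for n i j
    using L by (simp add: g_def divide_right_mono)
  have g_step: "g n (Suc i) - g n i = L / 2 ^ n" for n i
    by (simp add: g_def field_simps)
  have g_less: "g n i < g n (Suc i)" for n i using g_step[of n i] L by (smt (verit) divide_pos_pos zero_less_power)
  have Y_past: "Y t \<in> borel_measurable (past C u)" if "s \<le> t" "t \<le> u" for t u
    unfolding Y_def[abs_def] using that s
    by (intro borel_measurable_add borel_measurable_times borel_measurable_diff
          measurable_past_total_noise C borel_measurable_const) auto
  have A_bound: "ennreal (exp a) * emeasure M (A n) \<le> ennreal (exp (c * L))" for n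
  proof -
    let ?S = "\<lambda>i. Y (g n i)"
    let ?D = "\<lambda>j \<omega>. total_noise C (g n (Suc j)) \<omega> - total_noise C (g n j) \<omega>"
    have inc: "?S (Suc j) \<omega> - ?S j \<omega> = l * ?D j \<omega> + d * (L / 2 ^ n)" for j \<omega>
      using g_step[of n j] by (simp add: Y_def algebra_simps flip: g_step)
    have "ennreal (exp a) * emeasure M (A n) \<le> (\<integral>\<^sup>+\<omega>. ennreal (exp (?S (2 ^ n) \<omega>)) \<partial>M)"
      unfolding A_def
    proof (rule exp_maximal_inequality[where F = "\<lambda>i. past C (g n i)"])
      fix j
      show "?S j \<in> borel_measurable (past C (g n j))" using g_ge by (intro Y_past) auto
      show "indep_set (sets (past C (g n j))) {(\<lambda>\<omega>. ?S (Suc j) \<omega> - ?S j \<omega>) -` B \<inter> space M |B. B \<in> sets borel}"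
        unfolding indep_set_def
      proof (rule indep_sets_mono_sets[OF increment_indep_past[OF C g0 g_less[of n j], unfolded indep_set_def]])
        fix b :: bool
        have "\<exists>B'. (\<lambda>\<omega>. ?S (Suc j) \<omega> - ?S j \<omega>) -` B \<inter> space M = ?D j -` B' \<inter> space M \<and> B' \<in> sets borel"
          if "B \<in> sets borel" for B
        proof (intro exI conjI)
          show "(\<lambda>\<omega>. ?S (Suc j) \<omega> - ?S j \<omega>) -` B \<inter> space M
              = ?D j -` ((\<lambda>x. l * x + d * (L / 2 ^ n)) -` B) \<inter> space M"
            by (auto simp: inc)
          show "(\<lambda>x. l * x + d * (L / 2 ^ n)) -` B \<in> sets borel"
            by (rule measurable_sets_borel[OF _ that]) simp
        qed
        then show "(case b of True \<Rightarrow> sets (past C (g n j))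
              | False \<Rightarrow> {(\<lambda>\<omega>. ?S (Suc j) \<omega> - ?S j \<omega>) -` B \<inter> space M |B. B \<in> sets borel})
            \<subseteq> (case b of True \<Rightarrow> sets (past C (g n j))
              | False \<Rightarrow> {?D j -` B \<inter> space M |B. B \<in> sets borel})"
          by (cases b) (simp, simp, blast)
      qed
      have "(\<integral>\<^sup>+\<omega>. ennreal (exp (?S (Suc j) \<omega> - ?S j \<omega>)) \<partial>M)
          = (\<integral>\<^sup>+\<omega>. ennreal (exp (d * (L / 2 ^ n))) * ennreal (exp (l * ?D j \<omega>)) \<partial>M)"
        by (intro nn_integral_cong) (simp add: inc exp_add ennreal_mult mult.commute)
      also have "\<dots> = ennreal (exp (d * (L / 2 ^ n))) * (\<integral>\<^sup>+\<omega>. ennreal (exp (l * ?D j \<omega>)) \<partial>M)"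
      proof (rule nn_integral_cmult)
        note [measurable] = measurable_total_noise[OF C g0]
        show "(\<lambda>\<omega>. ennreal (exp (l * ?D j \<omega>))) \<in> borel_measurable M" by measurable
      qed
      also have "\<dots> = ennreal (exp (d * (L / 2 ^ n))) * ennreal (exp (l\<^sup>2 * real (card C) * (L / 2 ^ n) / 2))"
        by (subst nn_integral_exp_increment[OF C g0 g_less]) (simp add: g_step)
      also have "\<dots> = ennreal (exp (c * (L / 2 ^ n)))"
        by (simp add: ennreal_mult[symmetric] exp_add[symmetric] c(1) algebra_simps)
      also have "\<dots> \<ge> 1" using c(2) L by simp
      finally show "(\<integral>\<^sup>+\<omega>. ennreal (exp (?S (Suc j) \<omega> - ?S j \<omega>)) \<partial>M) \<ge> 1" .
    qed (rule past_subalgebra past_mono[OF g_mono], assumption?)+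
    also have "(\<integral>\<^sup>+\<omega>. ennreal (exp (?S (2 ^ n) \<omega>)) \<partial>M)
        = (\<integral>\<^sup>+\<omega>. ennreal (exp (d * L)) * ennreal (exp (l * (total_noise C (s + L) \<omega> - total_noise C s \<omega>))) \<partial>M)"
      by (intro nn_integral_cong) (simp add: Y_def g_def exp_add ennreal_mult mult.commute)
    also have "\<dots> = ennreal (exp (d * L)) * (\<integral>\<^sup>+\<omega>. ennreal (exp (l * (total_noise C (s + L) \<omega> - total_noise C s \<omega>))) \<partial>M)"
    proof (rule nn_integral_cmult)
      have "0 \<le> s + L" using s L by simp
      note [measurable] = measurable_total_noise[OF C s] measurable_total_noise[OF C this]
      show "(\<lambda>\<omega>. ennreal (exp (l * (total_noise C (s + L) \<omega> - total_noise C s \<omega>)))) \<in> borel_measurable M"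
        by measurable
    qed
    also have "\<dots> = ennreal (exp (c * L))"
      using L by (subst nn_integral_exp_increment[OF C s])
        (simp_all add: ennreal_mult[symmetric] exp_add[symmetric] c(1) algebra_simps)
    finally show ?thesis .
  qed
  have Y_M: "Y (g n i) \<in> borel_measurable M" for n i
    using measurable_from_subalg[OF past_subalgebra Y_past[OF g_ge order_refl]] .
  have A_events: "A n \<in> events" for n
  proof -
    have "A n = (\<Union>i\<le>2 ^ n. Y (g n i) -` {a..} \<inter> space M)" by (auto simp: A_def)
    also have "\<dots> \<in> events" by (intro sets.finite_UN measurable_sets[OF Y_M]) auto
    finally show ?thesis .
  qed
  have A_inc: "incseq A"
  proof (rule incseq_SucI, rule subsetI)
    fix n \<omega> assume "\<omega> \<in> A n"
    then obtain i where i: "\<omega> \<in> space M" "i \<le> 2 ^ n" "a \<le> Y (g n i) \<omega>" by (auto simp: A_def)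
    have "g n i = g (Suc n) (2 * i)" by (simp add: g_def)
    with i show "\<omega> \<in> A (Suc n)" unfolding A_def by (intro CollectI conjI exI[of _ "2 * i"]) auto
  qed
  have prob_A: "prob (A n) \<le> exp (c * L - a)" for n
  proof -
    have "ennreal (exp a * prob (A n)) \<le> ennreal (exp (c * L))"
      using A_bound[of n] by (simp add: emeasure_eq_measure ennreal_mult)
    then have "exp a * prob (A n) \<le> exp (c * L)" by simp
    then show ?thesis by (simp add: exp_diff field_simps)
  qed
  have "(\<lambda>n. prob (A n)) \<longlonglongrightarrow> prob (\<Union>n. A n)"
    using A_events A_inc by (intro finite_Lim_measure_incseq) auto
  then have "prob (\<Union>n. A n) \<le> exp (c * L - a)"
    by (rule LIMSEQ_le_const2) (use prob_A in auto)
  moreover have "(\<Union>n. A n) \<in> events" using A_events by auto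
  moreover have "Y t \<omega> \<le> a" if \<omega>: "\<omega> \<in> space M - (\<Union>n. A n)" and t: "t \<in> {s..s + L}" for \<omega> t
  proof -
    define i where "i n = nat \<lfloor>(t - s) / L * 2 ^ n\<rfloor>" for n :: nat
    have ratio: "0 \<le> (t - s) / L" "(t - s) / L \<le> 1" using t L by auto
    have i_le: "real (i n) \<le> (t - s) / L * 2 ^ n" and i_ge: "(t - s) / L * 2 ^ n - 1 \<le> real (i n)" for n
    proof -
      have "0 \<le> (t - s) / L * 2 ^ n" using ratio by (intro mult_nonneg_nonneg) auto
      then show "real (i n) \<le> (t - s) / L * 2 ^ n" "(t - s) / L * 2 ^ n - 1 \<le> real (i n)"
        unfolding i_def by linarith+
    qed
    have i_le': "i n \<le> 2 ^ n" for n
    proof -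
      have "real (i n) \<le> 1 * 2 ^ n"
        using ratio by (intro order_trans[OF i_le] mult_right_mono) auto
      then have "real (i n) \<le> real (2 ^ n)" by simp
      then show ?thesis by (simp only: of_nat_le_iff)
    qed
    have up: "g n (i n) \<le> t" for n
    proof -
      have "L * real (i n) / 2 ^ n \<le> L * ((t - s) / L * 2 ^ n) / 2 ^ n"
        using i_le[of n] L by (intro divide_right_mono mult_left_mono) auto
      then show ?thesis using L by (simp add: g_def)
    qed
    have low: "t - L / 2 ^ n \<le> g n (i n)" for n
    proof -
      have "L * ((t - s) / L * 2 ^ n - 1) / 2 ^ n \<le> L * real (i n) / 2 ^ n"
        using i_ge[of n] L by (intro divide_right_mono mult_left_mono) auto
      moreover have "L * ((t - s) / L * 2 ^ n - 1) / 2 ^ n = t - s - L / 2 ^ n"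
        using L by (simp add: field_simps)
      ultimately show ?thesis by (simp add: g_def)
    qed
    have "(\<lambda>n. t - L / 2 ^ n) \<longlonglongrightarrow> t - 0"
      by (intro tendsto_diff tendsto_const LIMSEQ_divide_realpow_zero) simp
    then have "(\<lambda>n. t - L / 2 ^ n) \<longlonglongrightarrow> t" by simp
    then have "(\<lambda>n. g n (i n)) \<longlonglongrightarrow> t"
      by (rule tendsto_sandwich[OF always_eventually[OF allI[OF low]] always_eventually[OF allI[OF up]]
            _ tendsto_const])
    moreover have "continuous_on {0..} (\<lambda>t. Y t \<omega>)"
      unfolding Y_def using \<omega> by (intro continuous_intros total_noise_continuous[OF C]) auto
    ultimately have "(\<lambda>n. Y (g n (i n)) \<omega>) \<longlonglongrightarrow> Y t \<omega>"
      using g0 t s by (intro continuous_on_tendsto_compose[where f = "\<lambda>t. Y t \<omega>"]) auto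
    moreover have "Y (g n (i n)) \<omega> \<le> a" for n
    proof -
      have "\<omega> \<in> space M" "\<omega> \<notin> A n" using \<omega> by auto
      then have "\<not> a \<le> Y (g n (i n)) \<omega>" using i_le'[of n] unfolding A_def by blast
      then show ?thesis by simp
    qed
    ultimately show ?thesis by (intro LIMSEQ_le_const2) auto
  qed
  ultimately show ?thesis unfolding Y_def by blast
qed

lemma increment_Chernoff:
  assumes C: "C \<subseteq> {1..N}" and st: "0 \<le> s" "s < t"
  shows "emeasure M {\<omega>\<in>space M. a \<le> l * (total_noise C t \<omega> - total_noise C s \<omega>)}
           \<le> ennreal (exp (l\<^sup>2 * real (card C) * (t - s) / 2 - a))"
proof -
  let ?Z = "\<lambda>\<omega>. l * (total_noise C t \<omega> - total_noise C s \<omega>)"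
  have "0 \<le> t" using st by simp
  note [measurable] = measurable_total_noise[OF C st(1)] measurable_total_noise[OF C this]
  have "emeasure M {\<omega>\<in>space M. a \<le> ?Z \<omega>} = (\<integral>\<^sup>+\<omega>. indicator {\<omega>\<in>space M. a \<le> ?Z \<omega>} \<omega> \<partial>M)"
    by (rule nn_integral_indicator[symmetric]) measurable
  also have "\<dots> \<le> (\<integral>\<^sup>+\<omega>. ennreal (exp (- a)) * ennreal (exp (?Z \<omega>)) \<partial>M)"
    by (intro nn_integral_mono)
       (auto split: split_indicator simp: ennreal_mult[symmetric] exp_add[symmetric])
  also have "\<dots> = ennreal (exp (- a)) * (\<integral>\<^sup>+\<omega>. ennreal (exp (?Z \<omega>)) \<partial>M)"
    by (rule nn_integral_cmult) measurable
  also have "\<dots> = ennreal (exp (l\<^sup>2 * real (card C) * (t - s) / 2 - a))"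
    by (subst nn_integral_exp_increment[OF C st])
       (simp add: ennreal_mult[symmetric] exp_add[symmetric])
  finally show ?thesis .
qed

end

section \<open>Alarm times along a fixed path\<close>

lemma groupwise_rule_between:
  assumes "i \<in> {1, 2, 3}" "j \<in> {1, 2, 3}" "i \<noteq> j"
  shows "min (group_alarm N \<mu> h (\<G> i) x) (group_alarm N \<mu> h (\<G> j) x) \<le> groupwise_rule N \<mu> \<G> h x"
    and "groupwise_rule N \<mu> \<G> h x \<le> max (group_alarm N \<mu> h (\<G> i) x) (group_alarm N \<mu> h (\<G> j) x)"
  using assms by (auto simp: groupwise_rule_def min_def max_def)

lemma group_alarm_le:
  assumes "0 \<le> s" "s \<le> t" "h \<le> group_llr N \<mu> G x t - group_llr N \<mu> G x s"
  shows "group_alarm N \<mu> h G x \<le> ennreal t"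
proof -
  have "group_min N \<mu> G x t \<le> ereal (group_llr N \<mu> G x s)"
    unfolding group_min_def using assms by (intro INF_lower) auto
  then have "ereal (group_llr N \<mu> G x t) - ereal (group_llr N \<mu> G x s) \<le> group_cusum N \<mu> G x t"
    unfolding group_cusum_def by (intro ereal_minus_mono order_refl)
  moreover have "ereal h \<le> ereal (group_llr N \<mu> G x t) - ereal (group_llr N \<mu> G x s)"
    using assms by simp
  ultimately have "ereal h \<le> group_cusum N \<mu> G x t" by (rule order_trans[rotated])
  then show ?thesis
    unfolding group_alarm_def using assms by (intro Inf_lower) auto
qed

lemma group_alarm_ge:
  assumes rise: "\<And>s t. 0 \<le> s \<Longrightarrow> s \<le> t \<Longrightarrow> t \<le> K \<Longrightarrow> group_llr N \<mu> G x t - group_llr N \<mu> G x s \<le> b"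
    and "b < h"
  shows "ennreal K \<le> group_alarm N \<mu> h G x"
  unfolding group_alarm_def
proof (rule Inf_greatest)
  fix y assume "y \<in> {ennreal t |t. 0 \<le> t \<and> ereal h \<le> group_cusum N \<mu> G x t}"
  then obtain t where t: "y = ennreal t" "0 \<le> t" "ereal h \<le> group_cusum N \<mu> G x t" by auto
  have "K < t"
  proof (rule ccontr)
    assume "\<not> K < t"
    then have "ereal (group_llr N \<mu> G x t - b) \<le> group_min N \<mu> G x t"
      unfolding group_min_def using rise[of _ t] by (intro INF_greatest) (auto simp: algebra_simps)
    then have "group_cusum N \<mu> G x t \<le> ereal (group_llr N \<mu> G x t) - ereal (group_llr N \<mu> G x t - b)"
      unfolding group_cusum_def by (intro ereal_minus_mono order_refl)
    with t(3) have "ereal h \<le> ereal (group_llr N \<mu> G x t) - ereal (group_llr N \<mu> G x t - b)"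
      by (rule order_trans)
    with \<open>b < h\<close> show False by simp
  qed
  then show "ennreal K \<le> y" by (simp add: t ennreal_leI)
qed

context sensor_network
begin

section \<open>Reports of honest groups\<close>

lemma llr_no_change:
  assumes "C \<subseteq> {1..N}" "c \<notin> C" "0 \<le> t"
  shows "group_llr N \<mu> C (report \<mu> W U \<infinity> c \<ss> \<omega>) t
           = \<mu> * total_noise C t \<omega> - 1/2 * (real N / 3) * \<mu>\<^sup>2 * t"
proof -
  have "report \<mu> W U \<infinity> c \<ss> \<omega> n t = W n t \<omega>" if "n \<in> C" for n
    using that assms by (auto simp: report_def signal_def)
  then show ?thesis by (simp add: group_llr_def total_noise_def sum_distrib_left)
qed

lemma llr_after_change:
  assumes "C \<subseteq> {1..N}" "c \<notin> C" "0 \<le> \<tau>" "\<tau> \<le> t" "real (card C) = real N / 3"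
  shows "group_llr N \<mu> C (report \<mu> W U (ennreal \<tau>) c \<ss> \<omega>) t
           = \<mu> * total_noise C t \<omega> + real N / 3 * \<mu>\<^sup>2 * (t - \<tau>) - 1/2 * (real N / 3) * \<mu>\<^sup>2 * t"
proof -
  have "report \<mu> W U (ennreal \<tau>) c \<ss> \<omega> n t = \<mu> * (t - \<tau>) + W n t \<omega>" if "n \<in> C" for n
    using that assms by (auto simp: report_def signal_def ennreal_minus)
  then have "group_llr N \<mu> C (report \<mu> W U (ennreal \<tau>) c \<ss> \<omega>) t
      = (\<Sum>n\<in>C. \<mu> * (\<mu> * (t - \<tau>)) + \<mu> * W n t \<omega>) - 1/2 * (real N / 3) * \<mu>\<^sup>2 * t"
    by (simp add: group_llr_def distrib_left)
  also have "(\<Sum>n\<in>C. \<mu> * (\<mu> * (t - \<tau>)) + \<mu> * W n t \<omega>)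
      = real (card C) * (\<mu> * (\<mu> * (t - \<tau>))) + \<mu> * total_noise C t \<omega>"
    by (simp add: sum.distrib total_noise_def sum_distrib_left)
  finally show ?thesis using assms(5) by (simp add: power2_eq_square)
qed

lemma measurable_past_signal:
  assumes "n \<in> {1..N}" "0 \<le> r" "n \<in> C \<Longrightarrow> r \<le> s"
  shows "signal \<mu> W \<tau> n r \<in> borel_measurable (past C s)"
  unfolding signal_def[abs_def]
  using measurable_past[OF assms] by (intro borel_measurable_add borel_measurable_const)

text \<open>The reports of the compromised sensor are functions of its own signal and of the randomisation,
  which the past knows completely because the compromised sensor is outside \<open>C\<close>.\<close>

lemma report_algebra_past:
  assumes C: "c \<in> {1..N}" "c \<notin> C" and \<ss>: "\<ss> \<in> attack_strategies R"
  shows "space (report_algebra M N (report \<mu> W U (ennreal \<tau>) c \<ss>) \<tau>) = space M" (is "space ?F = _")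
    and "sets (report_algebra M N (report \<mu> W U (ennreal \<tau>) c \<ss>) \<tau>) \<subseteq> sets (past C \<tau>)"
proof -
  let ?Y = "report \<mu> W U (ennreal \<tau>) c \<ss>"
  have Pow: "{(\<lambda>\<omega>. ?Y \<omega> n s) -` B \<inter> space M |n s B. n \<in> {1..N} \<and> s \<in> {0..\<tau>} \<and> B \<in> sets borel} \<subseteq> Pow (space M)"
    by auto
  show "space ?F = space M" unfolding report_algebra_def using Pow by (rule space_measure_of)
  have meas: "(\<lambda>\<omega>. ?Y \<omega> n s) \<in> borel_measurable (past C \<tau>)" if n: "n \<in> {1..N}" and s: "s \<in> {0..\<tau>}" for n s
  proof (cases "n = c")
    case False
    then have "(\<lambda>\<omega>. ?Y \<omega> n s) = signal \<mu> W (ennreal \<tau>) n s" by (auto simp: report_def)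
    then show ?thesis using n s by (auto intro: measurable_past_signal)
  next
    case True
    have path: "sample_path (signal \<mu> W (ennreal \<tau>) c) \<in> past C \<tau> \<rightarrow>\<^sub>M path_space"
      unfolding sample_path_def[abs_def]
      using C by (intro measurable_restrict measurable_past_signal) auto
    have "(\<lambda>(x, r). \<ss> x r s) \<in> borel_measurable (path_space \<Otimes>\<^sub>M R)"
      using \<ss> s by (auto simp: attack_strategies_def)
    from measurable_compose[OF measurable_Pair[OF path measurable_past_U] this] True
    show ?thesis by (simp add: report_def)
  qed
  have "{(\<lambda>\<omega>. ?Y \<omega> n s) -` B \<inter> space M |n s B. n \<in> {1..N} \<and> s \<in> {0..\<tau>} \<and> B \<in> sets borel} \<subseteq> sets (past C \<tau>)"
    using measurable_sets[OF meas] by auto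
  from sets.sigma_sets_subset[OF this]
  show "sets ?F \<subseteq> sets (past C \<tau>)"
    unfolding report_algebra_def sets_measure_of[OF Pow] by simp
qed

end

section \<open>Average run length\<close>

lemma honest_groups:
  assumes "three_groups N \<G>" "3 dvd N"
  obtains i j where "i \<in> {1, 2, 3}" "j \<in> {1, 2, 3}" "i \<noteq> j" "c \<notin> \<G> i" "c \<notin> \<G> j"
    "\<G> i \<subseteq> {1..N}" "\<G> j \<subseteq> {1..N}"
    "real (card (\<G> i)) = real N / 3" "real (card (\<G> j)) = real N / 3"
proof -
  have sub: "\<G> i \<subseteq> {1..N}" and card: "real (card (\<G> i)) = real N / 3" if "i \<in> {1, 2, 3}" for i
    using assms that unfolding three_groups_def by (blast, force simp: real_of_nat_div)
  have disj: "\<not> (c \<in> \<G> i \<and> c \<in> \<G> j)" if "i \<in> {1, 2, 3}" "j \<in> {1, 2, 3}" "i \<noteq> j" for i j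
    using assms that unfolding three_groups_def disjoint_family_on_def by blast
  have "\<exists>i j. i \<in> {1, 2, 3} \<and> j \<in> {1, 2, 3} \<and> i \<noteq> j \<and> c \<notin> \<G> i \<and> c \<notin> \<G> j"
  proof (cases "c \<in> \<G> 1")
    case True
    then show ?thesis using disj[of 1 2] disj[of 1 3] by (intro exI[of _ 2] exI[of _ 3]) auto
  next
    case False
    show ?thesis
    proof (cases "c \<in> \<G> 2")
      case True
      then show ?thesis using False disj[of 2 3] by (intro exI[of _ 1] exI[of _ 3]) auto
    next
      case False
      then show ?thesis using \<open>c \<notin> \<G> 1\<close> by (intro exI[of _ 1] exI[of _ 2]) auto
    qed
  qed
  then obtain i j where ij: "i \<in> {1, 2, 3}" "j \<in> {1, 2, 3}" "i \<noteq> j" "c \<notin> \<G> i" "c \<notin> \<G> j"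
    by (elim exE conjE)
  show ?thesis
    by (rule that[OF ij sub[OF ij(1)] sub[OF ij(2)] card[OF ij(1)] card[OF ij(2)]])
qed

context sensor_network
begin

text \<open>For a rise of more than \<open>x\<close> from time \<open>s\<close> to time \<open>t\<close>, compare with the last integer
  \<open>k \<le> s\<close>: either the log-likelihood ratio climbs by more than \<open>4/5 * x\<close> after \<open>k\<close>,
  or it falls by more than \<open>1/5 * x\<close> within one time unit after \<open>k\<close>. The likelihood ratio itself is a martingale,
  which makes the first event have probability at most \<open>exp (- 4/5 * x)\<close>. The power \<open>- 4\<close> of the
  likelihood ratio gives the same rate for the second event, at the price of the factor
  \<open>exp (10 * v)\<close> by which it grows on average in unit time.\<close>

lemma no_early_rise:
  assumes C: "C \<subseteq> {1..N}" "real (card C) = real N / 3" and x: "0 \<le> x"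
    and v: "v = real N / 3 * \<mu>\<^sup>2"
  shows "\<exists>A\<in>events. prob A \<le> real K * (2 * exp (10 * v - 4/5 * x)) \<and>
    (\<forall>\<omega>\<in>space M - A. \<forall>s t. 0 \<le> s \<and> s \<le> t \<and> t \<le> real K \<longrightarrow>
       (\<mu> * total_noise C t \<omega> - v / 2 * t) - (\<mu> * total_noise C s \<omega> - v / 2 * s) \<le> x)"
proof -
  let ?B = "total_noise C"
  have v0: "0 \<le> v" by (simp add: v)
  have "\<exists>A. A \<in> events \<and> prob A \<le> 2 * exp (10 * v - 4/5 * x) \<and>
      (\<forall>\<omega>\<in>space M - A. (\<forall>t\<in>{real k..real K}. \<mu> * (?B t \<omega> - ?B (real k) \<omega>) - v / 2 * (t - real k) \<le> 4/5 * x) \<and>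
        (\<forall>s\<in>{real k..real k + 1}. - 4 * \<mu> * (?B s \<omega> - ?B (real k) \<omega>) + 2 * v * (s - real k) \<le> 4/5 * x))"
    if k: "k < K" for k
  proof -
    obtain A1 where A1: "A1 \<in> events" "prob A1 \<le> exp (0 * (real K - real k) - 4/5 * x)"
      "\<forall>\<omega>\<in>space M - A1. \<forall>t\<in>{real k..real k + (real K - real k)}.
         \<mu> * (?B t \<omega> - ?B (real k) \<omega>) + (- v / 2) * (t - real k) \<le> 4/5 * x"
      using drifted_noise_maximal_inequality[OF C(1), of "real k" "real K - real k" 0 \<mu> "- v / 2" "4/5 * x"] k
      by (auto simp: v C(2))
    obtain A2 where A2: "A2 \<in> events" "prob A2 \<le> exp (10 * v * 1 - 4/5 * x)"
      "\<forall>\<omega>\<in>space M - A2. \<forall>t\<in>{real k..real k + 1}.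
         - 4 * \<mu> * (?B t \<omega> - ?B (real k) \<omega>) + 2 * v * (t - real k) \<le> 4/5 * x"
      using drifted_noise_maximal_inequality[OF C(1), of "real k" 1 "10 * v" "- 4 * \<mu>" "2 * v" "4/5 * x"] v0
      by (auto simp: v C(2) power_mult_distrib)
    have "prob (A1 \<union> A2) \<le> prob A1 + prob A2"
      using A1 A2 by (intro measure_Un_le) auto
    also have "\<dots> \<le> exp (10 * v - 4/5 * x) + exp (10 * v - 4/5 * x)"
      using A1(2) A2(2) v0 by (intro add_mono) (auto elim!: order_trans)
    finally have "prob (A1 \<union> A2) \<le> 2 * exp (10 * v - 4/5 * x)" by simp
    moreover have "A1 \<union> A2 \<in> events" using A1 A2 by auto
    ultimately show ?thesis using A1(3) A2(3) by (intro exI[of _ "A1 \<union> A2"]) auto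
  qed
  then have "\<forall>k\<in>{..<K}. \<exists>A. A \<in> events \<and> prob A \<le> 2 * exp (10 * v - 4/5 * x) \<and>
      (\<forall>\<omega>\<in>space M - A. (\<forall>t\<in>{real k..real K}. \<mu> * (?B t \<omega> - ?B (real k) \<omega>) - v / 2 * (t - real k) \<le> 4/5 * x) \<and>
        (\<forall>s\<in>{real k..real k + 1}. - 4 * \<mu> * (?B s \<omega> - ?B (real k) \<omega>) + 2 * v * (s - real k) \<le> 4/5 * x))"
    by blast
  from bchoice[OF this] obtain A where A': "\<forall>k\<in>{..<K}. A k \<in> events \<and> prob (A k) \<le> 2 * exp (10 * v - 4/5 * x) \<and>
      (\<forall>\<omega>\<in>space M - A k. (\<forall>t\<in>{real k..real K}. \<mu> * (?B t \<omega> - ?B (real k) \<omega>) - v / 2 * (t - real k) \<le> 4/5 * x) \<and>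
        (\<forall>s\<in>{real k..real k + 1}. - 4 * \<mu> * (?B s \<omega> - ?B (real k) \<omega>) + 2 * v * (s - real k) \<le> 4/5 * x))" ..
  have A: "\<And>k. k < K \<Longrightarrow> A k \<in> events" "\<And>k. k < K \<Longrightarrow> prob (A k) \<le> 2 * exp (10 * v - 4/5 * x)"
    "\<And>k \<omega> t. k < K \<Longrightarrow> \<omega> \<in> space M - A k \<Longrightarrow> t \<in> {real k..real K} \<Longrightarrow>
       \<mu> * (?B t \<omega> - ?B (real k) \<omega>) - v / 2 * (t - real k) \<le> 4/5 * x"
    "\<And>k \<omega> s. k < K \<Longrightarrow> \<omega> \<in> space M - A k \<Longrightarrow> s \<in> {real k..real k + 1} \<Longrightarrow>
       - 4 * \<mu> * (?B s \<omega> - ?B (real k) \<omega>) + 2 * v * (s - real k) \<le> 4/5 * x"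
    using A' by blast+
  have "prob (\<Union>k<K. A k) \<le> (\<Sum>k<K. prob (A k))"
    using A(1) by (intro finite_measure_subadditive_finite) auto
  also have "\<dots> \<le> real K * (2 * exp (10 * v - 4/5 * x))"
    using sum_bounded_above[of "{..<K}" "\<lambda>k. prob (A k)" "2 * exp (10 * v - 4/5 * x)"] A(2) by simp
  finally have "prob (\<Union>k<K. A k) \<le> real K * (2 * exp (10 * v - 4/5 * x))" .
  moreover have "(\<Union>k<K. A k) \<in> events" using A(1) by auto
  moreover have "(\<mu> * ?B t \<omega> - v / 2 * t) - (\<mu> * ?B s \<omega> - v / 2 * s) \<le> x"
    if \<omega>: "\<omega> \<in> space M - (\<Union>k<K. A k)" and st: "0 \<le> s" "s \<le> t" "t \<le> real K" for \<omega> s t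
  proof (cases "s = t")
    case False
    define k where "k = nat \<lfloor>s\<rfloor>"
    have k: "real k \<le> s" "s \<le> real k + 1" using st unfolding k_def by linarith+
    then have kK: "k < K" using st False by linarith
    have "\<omega> \<in> space M - A k" using \<omega> kK by auto
    from A(3)[OF kK this, of t] A(4)[OF kK this, of s] k st
    have "\<mu> * (?B t \<omega> - ?B (real k) \<omega>) - v / 2 * (t - real k) \<le> 4/5 * x"
      and "- 4 * \<mu> * (?B s \<omega> - ?B (real k) \<omega>) + 2 * v * (s - real k) \<le> 4/5 * x" by auto
    moreover have "- 4 * \<mu> * (?B s \<omega> - ?B (real k) \<omega>) + 2 * v * (s - real k)
        = - 4 * (\<mu> * (?B s \<omega> - ?B (real k) \<omega>) - v / 2 * (s - real k))"
      by (simp add: field_simps)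
    moreover have "(\<mu> * ?B t \<omega> - v / 2 * t) - (\<mu> * ?B s \<omega> - v / 2 * s)
        = (\<mu> * (?B t \<omega> - ?B (real k) \<omega>) - v / 2 * (t - real k))
        - (\<mu> * (?B s \<omega> - ?B (real k) \<omega>) - v / 2 * (s - real k))"
      by (simp add: field_simps)
    ultimately show ?thesis by linarith
  qed (use x in simp)
  ultimately show ?thesis by blast
qed

text \<open>Two groups are honest, and the second alarm cannot precede the first alarm of these two. With
  probability at least \<open>1/2\<close> neither of them raises an alarm before time \<open>K\<close>.\<close>

lemma average_run_length_ge:
  assumes G: "three_groups N \<G>" "3 dvd N" and h: "1 \<le> h" and v: "v = real N / 3 * \<mu>\<^sup>2"
    and K: "real K * (8 * exp (10 * v - 4/5 * (h - 1))) \<le> 1"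
  shows "ennreal (real K / 2) \<le> average_run_length M R N \<mu> W U (groupwise_rule N \<mu> \<G> h)"
  unfolding average_run_length_def
proof (intro INF_greatest)
  fix c \<ss> assume "c \<in> {1..N}"
  let ?Y = "report \<mu> W U \<infinity> c \<ss>"
  obtain i j where ij: "i \<in> {1, 2, 3}" "j \<in> {1, 2, 3}" "i \<noteq> j" and c: "c \<notin> \<G> i" "c \<notin> \<G> j"
    and sub: "\<G> i \<subseteq> {1..N}" "\<G> j \<subseteq> {1..N}"
    and card: "real (card (\<G> i)) = real N / 3" "real (card (\<G> j)) = real N / 3"
    using honest_groups[OF G, of c] by blast
  \<comment> \<open>The running minimum is an infimum, so the rise has to stay below \<open>h\<close> by a fixed amount, here
    by \<open>1\<close>.\<close>
  have no_alarm: "\<exists>A\<in>events. prob A \<le> 1/4 \<and>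
      (\<forall>\<omega>\<in>space M - A. ennreal (real K) \<le> group_alarm N \<mu> h C (?Y \<omega>))"
    if C: "C \<subseteq> {1..N}" "real (card C) = real N / 3" "c \<notin> C" for C
  proof -
    obtain A where A: "A \<in> events" "prob A \<le> real K * (2 * exp (10 * v - 4/5 * (h - 1)))"
      "\<forall>\<omega>\<in>space M - A. \<forall>s t. 0 \<le> s \<and> s \<le> t \<and> t \<le> real K \<longrightarrow>
       (\<mu> * total_noise C t \<omega> - v / 2 * t) - (\<mu> * total_noise C s \<omega> - v / 2 * s) \<le> h - 1"
      using no_early_rise[OF C(1,2) _ v, of "h - 1" K] h by auto
    have "ennreal (real K) \<le> group_alarm N \<mu> h C (?Y \<omega>)" if \<omega>: "\<omega> \<in> space M - A" for \<omega>
    proof (rule group_alarm_ge[where b = "h - 1"])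
      fix s t :: real assume st: "0 \<le> s" "s \<le> t" "t \<le> real K"
      then have "0 \<le> t" by simp
      from A(3)[rule_format, OF \<omega>, of s t] st
      show "group_llr N \<mu> C (?Y \<omega>) t - group_llr N \<mu> C (?Y \<omega>) s \<le> h - 1"
        unfolding llr_no_change[OF C(1,3) st(1)] llr_no_change[OF C(1,3) \<open>0 \<le> t\<close>] by (simp add: v)
    qed simp
    with A(1,2) K show ?thesis by (intro bexI[of _ A]) auto
  qed
  obtain A where A: "A \<in> events" "prob A \<le> 1/4"
      "\<forall>\<omega>\<in>space M - A. ennreal (real K) \<le> group_alarm N \<mu> h (\<G> i) (?Y \<omega>)"
    using no_alarm[OF sub(1) card(1) c(1)] by blast
  obtain A' where A': "A' \<in> events" "prob A' \<le> 1/4"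
      "\<forall>\<omega>\<in>space M - A'. ennreal (real K) \<le> group_alarm N \<mu> h (\<G> j) (?Y \<omega>)"
    using no_alarm[OF sub(2) card(2) c(2)] by blast
  have "prob (A \<union> A') \<le> prob A + prob A'" using A A' by (intro measure_Un_le) auto
  then have "1/2 \<le> 1 - prob (A \<union> A')" using A(2) A'(2) by linarith
  also have "\<dots> = prob (space M - (A \<union> A'))" using A A' by (intro prob_compl[symmetric]) auto
  finally have half: "real K / 2 \<le> real K * prob (space M - (A \<union> A'))"
    using mult_left_mono[of "1/2" "prob (space M - (A \<union> A'))" "real K"] by simp
  have "ennreal (real K / 2) \<le> ennreal (real K) * emeasure M (space M - (A \<union> A'))"
    using half by (simp add: emeasure_eq_measure ennreal_mult[symmetric])
  also have "\<dots> = (\<integral>\<^sup>+\<omega>. ennreal (real K) * indicator (space M - (A \<union> A')) \<omega> \<partial>M)"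
    using A A' by (intro nn_integral_cmult_indicator[symmetric]) auto
  also have "\<dots> \<le> (\<integral>\<^sup>+\<omega>. groupwise_rule N \<mu> \<G> h (?Y \<omega>) \<partial>M)"
  proof (rule nn_integral_mono)
    fix \<omega> assume "\<omega> \<in> space M"
    show "ennreal (real K) * indicator (space M - (A \<union> A')) \<omega> \<le> groupwise_rule N \<mu> \<G> h (?Y \<omega>)"
    proof (cases "\<omega> \<in> space M - (A \<union> A')")
      case True
      then have "ennreal (real K) \<le> min (group_alarm N \<mu> h (\<G> i) (?Y \<omega>)) (group_alarm N \<mu> h (\<G> j) (?Y \<omega>))"
        using A(3) A'(3) by auto
      also have "\<dots> \<le> groupwise_rule N \<mu> \<G> h (?Y \<omega>)" by (rule groupwise_rule_between(1)[OF ij])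
      finally show ?thesis using True by simp
    qed simp
  qed
  finally show "ennreal (real K / 2) \<le> (\<integral>\<^sup>+\<omega>. groupwise_rule N \<mu> \<G> h (?Y \<omega>) \<partial>M)" .
qed

end

section \<open>Detection delay\<close>

lemma (in prob_space) esssup_nn_cond_exp_le_of_indep:
  assumes sub: "subalgebra M F" and X: "X \<in> borel_measurable M"
    and indep: "\<And>a. a \<in> sets F \<Longrightarrow>
      (\<integral>\<^sup>+\<omega>. X \<omega> * indicator a \<omega> \<partial>M) = (\<integral>\<^sup>+\<omega>. X \<omega> \<partial>M) * emeasure M a"
  shows "esssup M (nn_cond_exp M F X) \<le> (\<integral>\<^sup>+\<omega>. X \<omega> \<partial>M)"
proof -
  interpret finite_measure_subalgebra M F using sub by unfold_locales
  have "AE \<omega> in M. (\<integral>\<^sup>+\<omega>. X \<omega> \<partial>M) = nn_cond_exp M F X \<omega>"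
  proof (rule nn_cond_exp_charact[OF _ X])
    fix a assume a: "a \<in> sets F"
    then have "a \<in> events" using sub by (auto simp: subalgebra_def)
    then show "(\<integral>\<^sup>+\<omega>\<in>a. X \<omega> \<partial>M) = (\<integral>\<^sup>+\<omega>\<in>a. (\<integral>\<^sup>+\<omega>. X \<omega> \<partial>M) \<partial>M)"
      by (simp add: indep[OF a] nn_integral_cmult_indicator)
  qed simp
  then show ?thesis by (intro esssup_I) auto
qed

lemma (in prob_space) nn_integral_suminf_indicator_indep:
  assumes A: "\<And>k :: nat. A k \<in> events" and a: "a \<in> events"
    and indep: "\<And>k. prob (a \<inter> A k) = prob a * prob (A k)"
  shows "(\<integral>\<^sup>+\<omega>. (\<Sum>k. indicator (A k) \<omega>) * indicator a \<omega> \<partial>M) = (\<Sum>k. emeasure M (A k)) * emeasure M a"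
proof -
  have "(\<integral>\<^sup>+\<omega>. (\<Sum>k. indicator (A k) \<omega>) * indicator a \<omega> \<partial>M)
      = (\<integral>\<^sup>+\<omega>. (\<Sum>k. indicator (a \<inter> A k) \<omega>) \<partial>M)"
    by (intro nn_integral_cong) (auto simp: indicator_inter_arith split: split_indicator)
  also have "\<dots> = (\<Sum>k. \<integral>\<^sup>+\<omega>. indicator (a \<inter> A k) \<omega> \<partial>M)"
    using A a by (intro nn_integral_suminf) auto
  also have "\<dots> = (\<Sum>k. emeasure M (A k) * emeasure M a)"
    using A a indep by (simp add: emeasure_eq_measure ennreal_mult[symmetric] mult.commute)
  finally show ?thesis by simp
qed

context sensor_network
begin

text \<open>The event that the log-likelihood ratio of the group \<open>C\<close> has risen by less than \<open>h\<close> in the \<open>k\<close>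
  time units after the change.\<close>

definition late :: "real \<Rightarrow> real \<Rightarrow> nat set \<Rightarrow> real \<Rightarrow> nat \<Rightarrow> 'a set" where
  "late \<mu> h C \<tau> k = {\<omega>\<in>space M.
     \<mu> * (total_noise C (\<tau> + real k) \<omega> - total_noise C \<tau> \<omega>) + 1/2 * (real N / 3) * \<mu>\<^sup>2 * real k < h}"

lemma late_event:
  assumes "C \<subseteq> {1..N}" "0 \<le> \<tau>"
  shows "late \<mu> h C \<tau> k \<in> events"
proof -
  have "0 \<le> \<tau> + real k" using assms by simp
  note [measurable] = measurable_total_noise[OF assms] measurable_total_noise[OF assms(1) this]
  show ?thesis unfolding late_def by measurable
qed

lemma late_indep_past:
  assumes "C \<subseteq> {1..N}" "0 \<le> \<tau>" "0 < k" "a \<in> sets (past C \<tau>)"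
  shows "prob (a \<inter> late \<mu> h C \<tau> k) = prob a * prob (late \<mu> h C \<tau> k)"
proof -
  have "{x. \<mu> * x + 1/2 * (real N / 3) * \<mu>\<^sup>2 * real k < h} \<in> sets borel" by measurable
  moreover have "late \<mu> h C \<tau> k = (\<lambda>\<omega>. total_noise C (\<tau> + real k) \<omega> - total_noise C \<tau> \<omega>)
      -` {x. \<mu> * x + 1/2 * (real N / 3) * \<mu>\<^sup>2 * real k < h} \<inter> space M"
    by (auto simp: late_def)
  ultimately have "late \<mu> h C \<tau> k
      \<in> {(\<lambda>\<omega>. total_noise C (\<tau> + real k) \<omega> - total_noise C \<tau> \<omega>) -` B \<inter> space M |B. B \<in> sets borel}"
    by blast
  moreover have "\<tau> < \<tau> + real k" using assms(3) by simp
  ultimately show ?thesis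
    using increment_indep_past[OF assms(1,2)] assms(4) by (blast intro: indep_setD)
qed

text \<open>Chernoff bound with exponent \<open>- 1/4\<close>. This exponent makes the bound small as soon as \<open>k\<close> exceeds
  \<open>8 * h / (3 * v)\<close>; the exponent \<open>- 1/2\<close> would give the largest decay rate in \<open>k\<close>, but only from
  \<open>4 * h / v\<close> on, which is too late for the final comparison.\<close>

lemma late_prob_le:
  assumes C: "C \<subseteq> {1..N}" "real (card C) = real N / 3" and \<tau>: "0 \<le> \<tau>" and k: "0 < k"
    and v: "v = real N / 3 * \<mu>\<^sup>2"
  shows "emeasure M (late \<mu> h C \<tau> k) \<le> ennreal (exp (h / 4 - 3 * v / 32 * real k))"
proof -
  let ?D = "\<lambda>\<omega>. total_noise C (\<tau> + real k) \<omega> - total_noise C \<tau> \<omega>"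
  let ?a = "v * real k / 8 - h / 4"
  have "0 \<le> \<tau> + real k" using \<tau> by simp
  note [measurable] = measurable_total_noise[OF C(1) \<tau>] measurable_total_noise[OF C(1) this]
  have "emeasure M (late \<mu> h C \<tau> k) \<le> emeasure M {\<omega>\<in>space M. ?a \<le> (- \<mu> / 4) * ?D \<omega>}"
    by (rule emeasure_mono) (auto simp: late_def v field_simps)
  also have "\<dots> \<le> ennreal (exp ((- \<mu> / 4)\<^sup>2 * real (card C) * (\<tau> + real k - \<tau>) / 2 - ?a))"
    using k by (intro increment_Chernoff[OF C(1) \<tau>]) simp
  also have "(- \<mu> / 4)\<^sup>2 * real (card C) * (\<tau> + real k - \<tau>) / 2 - ?a = h / 4 - 3 * v / 32 * real k"
    by (simp add: C(2) v power2_eq_square field_simps)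
  finally show ?thesis .
qed

lemma alarm_unless_late:
  assumes C: "C \<subseteq> {1..N}" "c \<notin> C" "real (card C) = real N / 3" and \<tau>: "0 \<le> \<tau>"
    and \<omega>: "\<omega> \<in> space M" "\<omega> \<notin> late \<mu> h C \<tau> k"
  shows "group_alarm N \<mu> h C (report \<mu> W U (ennreal \<tau>) c \<ss> \<omega>) \<le> ennreal (\<tau> + real k)"
proof (rule group_alarm_le[OF \<tau>])
  have ge: "h \<le> \<mu> * (total_noise C (\<tau> + real k) \<omega> - total_noise C \<tau> \<omega>) + 1/2 * (real N / 3) * \<mu>\<^sup>2 * real k"
    using \<omega> by (auto simp: late_def)
  show "h \<le> group_llr N \<mu> C (report \<mu> W U (ennreal \<tau>) c \<ss> \<omega>) (\<tau> + real k)
      - group_llr N \<mu> C (report \<mu> W U (ennreal \<tau>) c \<ss> \<omega>) \<tau>"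
    using ge \<tau> by (subst (1 2) llr_after_change[OF C(1,2) \<tau> _ C(3)]) (auto simp: field_simps)
qed simp

text \<open>Two groups are honest, and the second alarm comes no later than the last alarm of these two. So
  the delay is at most the first \<open>k \<ge> k0\<close> at which neither of the two groups is late, and hence at
  most \<open>k0\<close> plus the number of \<open>k \<ge> k0\<close> at which one of them is late, counted for
  each late group. This majorant is measurable
  for every attack, it is independent of the reports made before the change, so that its conditional
  expectation is constant, and its mean is at most \<open>k0\<close> plus two geometric series.\<close>

lemma detection_delay_le:
  assumes G: "three_groups N \<G>" "3 dvd N" and v: "v = real N / 3 * \<mu>\<^sup>2" "0 < v"
    and k0: "0 < k0" "h / 4 \<le> 3 * v / 32 * real k0"
  shows "detection_delay M R N \<mu> W U (groupwise_rule N \<mu> \<G> h)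
           \<le> ennreal (real k0 + 2 / (1 - exp (- 3 * v / 32)))"
  unfolding detection_delay_def
proof (intro SUP_least)
  fix \<tau> :: real and c \<ss>
  assume "\<tau> \<in> {0..}" and c: "c \<in> {1..N}" and \<ss>: "\<ss> \<in> attack_strategies R"
  then have \<tau>: "0 \<le> \<tau>" by simp
  let ?Y = "report \<mu> W U (ennreal \<tau>) c \<ss>"
  let ?F = "report_algebra M N ?Y \<tau>"
  let ?q = "exp (- 3 * v / 32)"
  obtain i j where ij: "i \<in> {1, 2, 3}" "j \<in> {1, 2, 3}" "i \<noteq> j" and cC: "c \<notin> \<G> i" "c \<notin> \<G> j"
    and sub: "\<G> i \<subseteq> {1..N}" "\<G> j \<subseteq> {1..N}"
    and card: "real (card (\<G> i)) = real N / 3" "real (card (\<G> j)) = real N / 3"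
    using honest_groups[OF G, of c] by blast
  define B where "B C l = late \<mu> h C \<tau> (k0 + l)" for C l
  \<comment> \<open>The measurable majorant of the delay.\<close>
  define X :: "'a \<Rightarrow> ennreal" where "X \<omega> = of_nat k0 + ((\<Sum>l. indicator (B (\<G> i) l) \<omega>) + (\<Sum>l. indicator (B (\<G> j) l) \<omega>))"
    for \<omega>
  have B_events: "B C l \<in> events" if "C \<subseteq> {1..N}" for C l
    unfolding B_def using that \<tau> by (rule late_event)
  have spF: "space ?F = space M" using report_algebra_past(1)[OF c cC(1) \<ss>] .
  have subF: "subalgebra M ?F"
    using report_algebra_past[OF c cC(1) \<ss>, of \<mu> \<tau>] past_subalgebra[of "\<G> i" \<tau>]
    by (auto simp: subalgebra_def)
  have sum_meas: "(\<lambda>\<omega>. \<Sum>l. indicator (B C l) \<omega> :: ennreal) \<in> borel_measurable M" if "C \<subseteq> {1..N}" for C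
    using B_events[OF that] by (intro borel_measurable_suminf_order borel_measurable_indicator)
  have X_meas: "X \<in> borel_measurable M"
    unfolding X_def[abs_def] using sum_meas[OF sub(1)] sum_meas[OF sub(2)] by simp
  have X_split: "(\<integral>\<^sup>+\<omega>. X \<omega> * indicator a \<omega> \<partial>M)
      = (of_nat k0 + ((\<Sum>l. emeasure M (B (\<G> i) l)) + (\<Sum>l. emeasure M (B (\<G> j) l)))) * emeasure M a"
    if a: "a \<in> events" and "a \<in> sets (past (\<G> i) \<tau>)" "a \<in> sets (past (\<G> j) \<tau>)" for a
  proof -
    have ind: "(\<integral>\<^sup>+\<omega>. (\<Sum>l. indicator (B C l) \<omega>) * indicator a \<omega> \<partial>M) = (\<Sum>l. emeasure M (B C l)) * emeasure M a"
      if "C \<subseteq> {1..N}" "a \<in> sets (past C \<tau>)" for C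
      using that k0 by (intro nn_integral_suminf_indicator_indep B_events a)
        (auto simp: B_def intro!: late_indep_past \<tau>)
    note [measurable] = sum_meas[OF sub(1)] sum_meas[OF sub(2)] a
    have "(\<integral>\<^sup>+\<omega>. X \<omega> * indicator a \<omega> \<partial>M)
        = (\<integral>\<^sup>+\<omega>. of_nat k0 * indicator a \<omega> + ((\<Sum>l. indicator (B (\<G> i) l) \<omega>) * indicator a \<omega>
            + (\<Sum>l. indicator (B (\<G> j) l) \<omega>) * indicator a \<omega>) \<partial>M)"
      by (simp add: X_def distrib_right)
    also have "\<dots> = (\<integral>\<^sup>+\<omega>. of_nat k0 * indicator a \<omega> \<partial>M)
        + ((\<integral>\<^sup>+\<omega>. (\<Sum>l. indicator (B (\<G> i) l) \<omega>) * indicator a \<omega> \<partial>M)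
            + (\<integral>\<^sup>+\<omega>. (\<Sum>l. indicator (B (\<G> j) l) \<omega>) * indicator a \<omega> \<partial>M))"
      by (simp add: nn_integral_add)
    also have "\<dots> = of_nat k0 * emeasure M a + ((\<Sum>l. emeasure M (B (\<G> i) l)) * emeasure M a
        + (\<Sum>l. emeasure M (B (\<G> j) l)) * emeasure M a)"
      using ind[OF sub(1)] ind[OF sub(2)] that a by (simp add: nn_integral_cmult_indicator)
    finally show ?thesis by (simp add: distrib_right)
  qed
  have top_past: "space M \<in> sets (past C \<tau>)" for C using sets.top[of "past C \<tau>"] by simp
  have "(\<integral>\<^sup>+\<omega>. X \<omega> \<partial>M) = (\<integral>\<^sup>+\<omega>. X \<omega> * indicator (space M) \<omega> \<partial>M)"
    by (intro nn_integral_cong) simp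
  also have "\<dots> = of_nat k0 + ((\<Sum>l. emeasure M (B (\<G> i) l)) + (\<Sum>l. emeasure M (B (\<G> j) l)))"
    using X_split[OF sets.top top_past top_past] by (simp add: emeasure_space_1)
  finally have EX: "(\<integral>\<^sup>+\<omega>. X \<omega> \<partial>M) = \<dots>" .
  have "esssup M (nn_cond_exp M ?F X) \<le> (\<integral>\<^sup>+\<omega>. X \<omega> \<partial>M)"
  proof (rule esssup_nn_cond_exp_le_of_indep[OF subF X_meas])
    fix a assume a: "a \<in> sets ?F"
    have "a \<in> sets (past (\<G> i) \<tau>)" "a \<in> sets (past (\<G> j) \<tau>)"
      using report_algebra_past(2)[OF c cC(1) \<ss>] report_algebra_past(2)[OF c cC(2) \<ss>] a by blast+
    moreover have "a \<in> events" using subF a by (auto simp: subalgebra_def)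
    ultimately show "(\<integral>\<^sup>+\<omega>. X \<omega> * indicator a \<omega> \<partial>M) = (\<integral>\<^sup>+\<omega>. X \<omega> \<partial>M) * emeasure M a"
      unfolding EX by (intro X_split)
  qed
  also have "\<dots> \<le> ennreal (real k0 + 2 / (1 - ?q))"
  proof -
    have q: "0 \<le> ?q" "?q < 1" using v by auto
    have tail: "(\<Sum>l. emeasure M (B C l)) \<le> ennreal (1 / (1 - ?q))"
      if C: "C \<subseteq> {1..N}" "real (card C) = real N / 3" for C
    proof -
      have "emeasure M (B C l) \<le> ennreal (?q ^ l)" for l
      proof -
        have "emeasure M (B C l) \<le> ennreal (exp (h / 4 - 3 * v / 32 * real (k0 + l)))"
          unfolding B_def using k0 by (intro late_prob_le[OF C \<tau> _ v(1)]) simp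
        also have "\<dots> \<le> ennreal (exp (real l * (- 3 * v / 32)))"
          using k0(2) by (intro ennreal_leI) (simp add: algebra_simps)
        finally show ?thesis by (simp only: exp_of_nat_mult)
      qed
      then have "(\<Sum>l. emeasure M (B C l)) \<le> (\<Sum>l. ennreal (?q ^ l))"
        by (intro suminf_le summableI)
      also have "\<dots> = ennreal (\<Sum>l. ?q ^ l)"
        using q by (intro suminf_ennreal2 summable_geometric) auto
      also have "(\<Sum>l. ?q ^ l) = 1 / (1 - ?q)"
        using q by (intro suminf_geometric) auto
      finally show ?thesis .
    qed
    have "(\<integral>\<^sup>+\<omega>. X \<omega> \<partial>M) \<le> of_nat k0 + (ennreal (1 / (1 - ?q)) + ennreal (1 / (1 - ?q)))"
      unfolding EX by (intro add_mono order_refl tail sub card)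
    also have "\<dots> = ennreal (real k0 + 2 / (1 - ?q))"
      using q by (simp add: ennreal_of_nat_eq_real_of_nat ennreal_plus[symmetric] del: ennreal_plus)
    finally show ?thesis .
  qed
  finally have bound: "esssup M (nn_cond_exp M ?F X) \<le> ennreal (real k0 + 2 / (1 - ?q))" .
  have "groupwise_rule N \<mu> \<G> h (?Y \<omega>) - ennreal \<tau> \<le> X \<omega>" if \<omega>: "\<omega> \<in> space M" for \<omega>
  proof -
    define f where "f l = (indicator (B (\<G> i) l) \<omega> + indicator (B (\<G> j) l) \<omega> :: ennreal)" for l
    have X_f: "X \<omega> = of_nat k0 + (\<Sum>l. f l)"
      unfolding X_def f_def by (subst suminf_add) (auto intro: summableI)
    have f1: "1 \<le> f l" if "f l \<noteq> 0" for l
      using that by (cases "\<omega> \<in> B (\<G> i) l"; cases "\<omega> \<in> B (\<G> j) l") (simp_all add: f_def)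
    have count: "of_nat n \<le> (\<Sum>l. f l)" if "\<And>l. l < n \<Longrightarrow> f l \<noteq> 0" for n
    proof -
      have "of_nat n = (\<Sum>l<n. 1 :: ennreal)" by simp
      also have "\<dots> \<le> (\<Sum>l<n. f l)" using that f1 by (intro sum_mono) auto
      also have "\<dots> \<le> (\<Sum>l. f l)" by (intro sum_le_suminf summableI) auto
      finally show ?thesis .
    qed
    show ?thesis
    proof (cases "\<exists>l. f l = 0")
      case True
      define n where "n = (LEAST l. f l = 0)"
      have "f n = 0" using LeastI_ex[OF True] by (simp add: n_def)
      then have "\<omega> \<notin> B (\<G> i) n" "\<omega> \<notin> B (\<G> j) n"
        by (cases "\<omega> \<in> B (\<G> i) n"; cases "\<omega> \<in> B (\<G> j) n"; simp add: f_def)+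
      then have "max (group_alarm N \<mu> h (\<G> i) (?Y \<omega>)) (group_alarm N \<mu> h (\<G> j) (?Y \<omega>)) \<le> ennreal (\<tau> + real (k0 + n))"
        unfolding B_def
        using alarm_unless_late[OF sub(1) cC(1) card(1) \<tau> \<omega>] alarm_unless_late[OF sub(2) cC(2) card(2) \<tau> \<omega>]
        by (intro max.boundedI) blast+
      with groupwise_rule_between(2)[OF ij]
      have "groupwise_rule N \<mu> \<G> h (?Y \<omega>) \<le> ennreal (\<tau> + real (k0 + n))" by (rule order_trans)
      then have "groupwise_rule N \<mu> \<G> h (?Y \<omega>) - ennreal \<tau> \<le> ennreal (\<tau> + real (k0 + n)) - ennreal \<tau>"
        by (intro ennreal_minus_mono order_refl)
      also have "\<dots> = of_nat k0 + of_nat n"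
        using \<tau> by (simp add: ennreal_minus ennreal_of_nat_eq_real_of_nat ennreal_plus[symmetric] del: ennreal_plus)
      also have "\<dots> \<le> X \<omega>"
        unfolding X_f by (intro add_left_mono count) (use not_less_Least in \<open>unfold n_def, blast\<close>)
      finally show ?thesis .
    next
      case False
      then have "of_nat n \<le> (\<Sum>l. f l)" for n by (intro count) auto
      then have "(\<Sum>l. f l) = top"
        using ennreal_Ex_less_of_nat[of "\<Sum>l. f l"] by (meson leD less_top)
      then show ?thesis by (simp add: X_f)
    qed
  qed
  then have "esssup_cond_exp M ?F (\<lambda>\<omega>. groupwise_rule N \<mu> \<G> h (?Y \<omega>) - ennreal \<tau>) \<le> esssup M (nn_cond_exp M ?F X)"
    unfolding esssup_cond_exp_def using X_meas by (intro INF_lower) auto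
  also note bound
  finally show "esssup_cond_exp M ?F (\<lambda>\<omega>. groupwise_rule N \<mu> \<G> h (?Y \<omega>) - ennreal \<tau>)
      \<le> ennreal (real k0 + 2 / (1 - ?q))" .
qed

end

section \<open>Comparison of delay and run length\<close>

lemma ln_ennreal_ge:
  assumes "ennreal (exp y) \<le> x"
  shows "ereal y \<le> ln_ennreal x"
proof (cases x)
  case (real r)
  then have "exp y \<le> r" using assms by simp
  moreover from this have "0 < r" using exp_gt_zero[of y] by linarith
  ultimately show ?thesis using real by (simp add: ln_ennreal_def ln_ge_iff)
qed (simp add: ln_ennreal_def)

theorem theorem3p7:
  fixes M :: "'a measure" and R :: "'r measure"
    and W :: "nat \<Rightarrow> real \<Rightarrow> 'a \<Rightarrow> real" and U :: "'a \<Rightarrow> 'r"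
    and N :: nat and \<mu> :: real and \<G> :: "nat \<Rightarrow> nat set"
  assumes "N \<ge> 3" and "3 dvd N" and "\<mu> \<noteq> 0"
    and "sensor_noise M R N W U"
    and "three_groups N \<G>"
  shows "\<exists>\<epsilon> :: real \<Rightarrow> real. (\<epsilon> \<longlongrightarrow> 0) at_top \<and>
    (\<forall>\<^sub>F h in at_top.
       enn2ereal (detection_delay M R N \<mu> W U (groupwise_rule N \<mu> \<G> h))
         \<le> ereal (12 / (\<mu>\<^sup>2 * real N)) *
            (ln_ennreal (average_run_length M R N \<mu> W U (groupwise_rule N \<mu> \<G> h))
              + ereal (ln (real N * \<mu>\<^sup>2 / 3)) - 1 + ereal (\<epsilon> h)))"
proof (intro exI conjI)
  interpret sensor_network M R N W U by unfold_locales fact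
  show "((\<lambda>_. 0 :: real) \<longlongrightarrow> 0) at_top" by simp
  define v where "v = real N / 3 * \<mu>\<^sup>2"
  have v: "0 < v" using assms by (simp add: v_def)
  \<comment> \<open>The constants are chosen such that \<open>exp (4/5 * h - b)\<close> is the largest horizon to which the
    bound for the run length applies.\<close>
  define b where "b = 10 * v + 4/5 + ln 8"
  define D where "D = 2 + 2 / (1 - exp (- 3 * v / 32))"
  let ?d = "\<lambda>h. detection_delay M R N \<mu> W U (groupwise_rule N \<mu> \<G> h)"
  let ?a = "\<lambda>h. average_run_length M R N \<mu> W U (groupwise_rule N \<mu> \<G> h)"
  have delay: "?d h \<le> ennreal (8 * h / (3 * v) + D)" if h: "1 \<le> h" for h
  proof -
    define k0 where "k0 = nat \<lceil>8 * h / (3 * v)\<rceil> + 1"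
    have "0 \<le> 8 * h / (3 * v)" using h v by simp
    then have k0: "8 * h / (3 * v) \<le> real k0" "real k0 \<le> 8 * h / (3 * v) + 2"
      unfolding k0_def by linarith+
    have "h / 4 = 3 * v / 32 * (8 * h / (3 * v))" using v by simp
    also have "\<dots> \<le> 3 * v / 32 * real k0" using k0(1) v by (intro mult_left_mono) auto
    finally have "?d h \<le> ennreal (real k0 + 2 / (1 - exp (- 3 * v / 32)))"
      by (intro detection_delay_le[OF assms(5,2) v_def v]) (simp_all add: k0_def)
    also have "\<dots> \<le> ennreal (8 * h / (3 * v) + D)"
      using k0(2) by (intro ennreal_leI) (simp add: D_def)
    finally show ?thesis .
  qed
  have arl: "ereal (4/5 * h - b - ln 4) \<le> ln_ennreal (?a h)" if h: "1 \<le> h" "2 \<le> exp (4/5 * h - b)" for h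
  proof (rule ln_ennreal_ge)
    define K where "K = nat \<lfloor>exp (4/5 * h - b)\<rfloor>"
    have K: "real K \<le> exp (4/5 * h - b)" "exp (4/5 * h - b) - 1 \<le> real K"
      using exp_ge_zero[of "4/5 * h - b"] unfolding K_def by linarith+
    have "8 * exp (10 * v - 4/5 * (h - 1)) = exp (ln 8) * exp (10 * v - 4/5 * (h - 1))" by simp
    also have "\<dots> = exp (- (4/5 * h - b))"
      unfolding exp_add[symmetric] by (simp add: b_def field_simps)
    finally have "real K * (8 * exp (10 * v - 4/5 * (h - 1))) = real K * exp (- (4/5 * h - b))" by simp
    also have "\<dots> \<le> exp (4/5 * h - b) * exp (- (4/5 * h - b))"
      using K(1) by (intro mult_right_mono) auto
    also have "\<dots> = 1" by (simp only: exp_add[symmetric]) simp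
    finally have "ennreal (real K / 2) \<le> ?a h"
      by (intro average_run_length_ge[OF assms(5,2) h(1) v_def])
    moreover have "exp (4/5 * h - b - ln 4) = exp (4/5 * h - b) / 4" by (simp add: exp_diff)
    then have "ennreal (exp (4/5 * h - b - ln 4)) \<le> ennreal (real K / 2)"
      using K(2) h(2) by (intro ennreal_leI) linarith
    ultimately show "ennreal (exp (4/5 * h - b - ln 4)) \<le> ?a h" by (rule order_trans[rotated])
  qed
  \<comment> \<open>The slopes in \<open>h\<close> are \<open>8 / (3 * v)\<close> on the left and \<open>16 / (5 * v)\<close> on the right.\<close>
  have ev: "\<forall>\<^sub>F h in at_top. 1 \<le> h \<and> 2 \<le> exp (4/5 * h - b) \<and>
      8 * h / (3 * v) + D \<le> 4 / v * (4/5 * h - b - ln 4 + ln v - 1)"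
  proof -
    define h0 where "h0 = 15 * v / 8 * (D + 4 / v * (b + ln 4 - ln v + 1))"
    have "8 * h / (3 * v) + D \<le> 4 / v * (4/5 * h - b - ln 4 + ln v - 1)" if "h0 \<le> h" for h
    proof -
      have "D + 4 / v * (b + ln 4 - ln v + 1) = 8 / (15 * v) * h0" using v by (simp add: h0_def)
      also have "\<dots> \<le> 8 / (15 * v) * h" using that v by (intro mult_left_mono) auto
      finally show ?thesis using v by (simp add: field_simps)
    qed
    moreover have "2 \<le> exp (4/5 * h - b)" if "5/4 * (b + ln 2) \<le> h" for h
    proof -
      have "ln 2 \<le> 4/5 * h - b" using that by (simp add: field_simps)
      then have "exp (ln 2) \<le> exp (4/5 * h - b)" by (simp only: exp_le_cancel_iff)
      moreover have "exp (ln 2) = (2 :: real)" by simp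
      ultimately show ?thesis by (simp only:)
    qed
    ultimately show ?thesis
      by (intro eventually_at_top_linorderI[of "max 1 (max h0 (5/4 * (b + ln 2)))"]) auto
  qed
  show "\<forall>\<^sub>F h in at_top. enn2ereal (?d h)
      \<le> ereal (12 / (\<mu>\<^sup>2 * real N)) * (ln_ennreal (?a h) + ereal (ln (real N * \<mu>\<^sup>2 / 3)) - 1 + ereal 0)"
    using ev
  proof eventually_elim
    case (elim h)
    have coeff: "12 / (\<mu>\<^sup>2 * real N) = 4 / v" "real N * \<mu>\<^sup>2 / 3 = v"
      by (simp_all add: v_def)
    have "0 \<le> 8 * h / (3 * v) + D" using elim v by (simp add: D_def)
    then have "enn2ereal (?d h) \<le> ereal (8 * h / (3 * v) + D)"
      using delay[of h] elim by (simp add: less_eq_ennreal.rep_eq enn2ereal_ennreal)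
    also have "\<dots> \<le> ereal (4 / v) * (ereal (4/5 * h - b - ln 4) + ereal (ln v) - 1 + ereal 0)"
      using elim by (simp add: one_ereal_def)
    also have "\<dots> \<le> ereal (4 / v) * (ln_ennreal (?a h) + ereal (ln v) - 1 + ereal 0)"
      using elim v by (intro ereal_mult_left_mono add_mono ereal_minus_mono arl order_refl) auto
    finally show ?case unfolding coeff .
  qed
qed

end
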